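(* The theory $P\Sigma_1$ can be axiomatized by a set of $\Pi_3$ sentences, and this is optimal: $P\Sigma_1$ cannot be axiomatized (over $P^-$) by a set of $\Sigma_3$ sentences, i.e. it is not $\Delta_3$-axiomatizable over $P^-$.
   Context: $P^-$ is Peano arithmetic without induction; $I\Sigma_1$ is $P^-$ plus induction for $\Sigma_1$-formulas. Finite sequences are coded by numbers; $\mathrm{lth}(s)$ is the length of the sequence coded by $s$ and $(s)_i$ its $i$-th entry. For a formula $\phi(x,y)$ (possibly with parameters), $\mathsf{PFUN}(\phi)$ states that for every $x$ there is at most one $y$ with $\phi(x,y)$; $\mathsf{Approx}_\phi(s)$ states that $s$ codes a finite sequence with: for all $i<\mathrm{lth}(s)-1$ and all $x,y$, if $x\le (s)_i$ and $\phi(x,y)$ then $y\le (s)_{i+1}$. $P\phi$ is $\mathsf{PFUN}(\phi)\to\forall z\,\exists s\,(\mathsf{Approx}_\phi(s)\wedge \mathrm{lth}(s)=z)$, and $P\Sigma_1$ is $I\Sigma_1$ together with all $P\phi$ for $\phi\in\Sigma_1$. *)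

theory Defs
  imports Main
begin

text \<open>
  First-order logic with equality over the language of ordered rings, with de Bruijn indices:
  \<open>Var 0\<close> refers to the innermost enclosing quantifier.
\<close>

datatype tm = Var nat | Zero | One | Add tm tm | Mul tm tm

datatype fm = Eq tm tm | Less tm tm | Bot | Imp fm fm | All fm

definition Neg :: "fm \<Rightarrow> fm" where
  "Neg \<phi> = Imp \<phi> Bot"

definition Or :: "fm \<Rightarrow> fm \<Rightarrow> fm" where
  "Or \<phi> \<psi> = Imp (Neg \<phi>) \<psi>"

definition And :: "fm \<Rightarrow> fm \<Rightarrow> fm" where
  "And \<phi> \<psi> = Neg (Imp \<phi> (Neg \<psi>))"

definition Iff :: "fm \<Rightarrow> fm \<Rightarrow> fm" where
  "Iff \<phi> \<psi> = And (Imp \<phi> \<psi>) (Imp \<psi> \<phi>)"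

definition Ex :: "fm \<Rightarrow> fm" where
  "Ex \<phi> = Neg (All (Neg \<phi>))"

definition Leq :: "tm \<Rightarrow> tm \<Rightarrow> fm" where
  "Leq s t = Or (Less s t) (Eq s t)"

primrec substt :: "(nat \<Rightarrow> tm) \<Rightarrow> tm \<Rightarrow> tm" where
  "substt \<sigma> (Var n) = \<sigma> n"
| "substt \<sigma> Zero = Zero"
| "substt \<sigma> One = One"
| "substt \<sigma> (Add s t) = Add (substt \<sigma> s) (substt \<sigma> t)"
| "substt \<sigma> (Mul s t) = Mul (substt \<sigma> s) (substt \<sigma> t)"

definition shift :: "nat \<Rightarrow> tm \<Rightarrow> tm" where
  "shift k t = substt (\<lambda>n. Var (n + k)) t"

primrec subst :: "(nat \<Rightarrow> tm) \<Rightarrow> fm \<Rightarrow> fm" where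
  "subst \<sigma> (Eq s t) = Eq (substt \<sigma> s) (substt \<sigma> t)"
| "subst \<sigma> (Less s t) = Less (substt \<sigma> s) (substt \<sigma> t)"
| "subst \<sigma> Bot = Bot"
| "subst \<sigma> (Imp \<phi> \<psi>) = Imp (subst \<sigma> \<phi>) (subst \<sigma> \<psi>)"
| "subst \<sigma> (All \<phi>) = All (subst (case_nat (Var 0) (\<lambda>n. shift 1 (\<sigma> n))) \<phi>)"

text \<open>
  \<open>inst ts k \<phi>\<close> replaces the first \<open>length ts\<close> variables of \<open>\<phi>\<close> by the terms \<open>ts\<close>; the remaining
  variables, which act as the parameters of \<open>\<phi>\<close>, are renamed to start at \<open>Var k\<close>. So it is the
  instance \<open>\<phi>(ts)\<close> placed below \<open>k\<close> quantifiers that do not bind the parameters.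
\<close>

definition inst :: "tm list \<Rightarrow> nat \<Rightarrow> fm \<Rightarrow> fm" where
  "inst ts k \<phi> =
     subst (\<lambda>n. if n < length ts then ts ! n else Var (n - length ts + k)) \<phi>"

text \<open>\<open>fvbt\<close> and \<open>fvb\<close> give the least strict upper bound on the free variables.\<close>

primrec fvbt :: "tm \<Rightarrow> nat" where
  "fvbt (Var n) = Suc n"
| "fvbt Zero = 0"
| "fvbt One = 0"
| "fvbt (Add s t) = max (fvbt s) (fvbt t)"
| "fvbt (Mul s t) = max (fvbt s) (fvbt t)"

primrec fvb :: "fm \<Rightarrow> nat" where
  "fvb (Eq s t) = max (fvbt s) (fvbt t)"
| "fvb (Less s t) = max (fvbt s) (fvbt t)"
| "fvb Bot = 0"
| "fvb (Imp \<phi> \<psi>) = max (fvb \<phi>) (fvb \<psi>)"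
| "fvb (All \<phi>) = fvb \<phi> - 1"

definition sentence :: "fm \<Rightarrow> bool" where
  "sentence \<phi> \<longleftrightarrow> fvb \<phi> = 0"

definition univ_closure :: "fm \<Rightarrow> fm" where
  "univ_closure \<phi> = (All ^^ fvb \<phi>) \<phi>"

text \<open>Natural deduction for classical first-order logic with equality.\<close>

inductive proves :: "fm set \<Rightarrow> fm \<Rightarrow> bool" (infix "\<turnstile>" 50) where
  Assm: "\<phi> \<in> \<Gamma> \<Longrightarrow> \<Gamma> \<turnstile> \<phi>"
| ImpI: "insert \<phi> \<Gamma> \<turnstile> \<psi> \<Longrightarrow> \<Gamma> \<turnstile> Imp \<phi> \<psi>"
| ImpE: "\<Gamma> \<turnstile> Imp \<phi> \<psi> \<Longrightarrow> \<Gamma> \<turnstile> \<phi> \<Longrightarrow> \<Gamma> \<turnstile> \<psi>"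
| Contr: "insert (Neg \<phi>) \<Gamma> \<turnstile> Bot \<Longrightarrow> \<Gamma> \<turnstile> \<phi>"
| AllI: "inst [] 1 ` \<Gamma> \<turnstile> \<phi> \<Longrightarrow> \<Gamma> \<turnstile> All \<phi>"
| AllE: "\<Gamma> \<turnstile> All \<phi> \<Longrightarrow> \<Gamma> \<turnstile> inst [t] 0 \<phi>"
| EqRefl: "\<Gamma> \<turnstile> Eq t t"
| EqSubst: "\<Gamma> \<turnstile> Eq s t \<Longrightarrow> \<Gamma> \<turnstile> inst [s] 0 \<phi> \<Longrightarrow> \<Gamma> \<turnstile> inst [t] 0 \<phi>"

definition same_theorems :: "fm set \<Rightarrow> fm set \<Rightarrow> bool" where
  "same_theorems S T \<longleftrightarrow> (\<forall>\<phi>. sentence \<phi> \<longrightarrow> (S \<turnstile> \<phi> \<longleftrightarrow> T \<turnstile> \<phi>))"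

text \<open>
  The arithmetical hierarchy. In a bounded quantifier the bound \<open>t\<close> is shifted, so it cannot
  contain the bound variable. Quantifiers come in blocks of arbitrary, possibly zero, length.
\<close>

definition BAll :: "tm \<Rightarrow> fm \<Rightarrow> fm" where
  "BAll t \<phi> = All (Imp (Less (Var 0) (shift 1 t)) \<phi>)"

definition BEx :: "tm \<Rightarrow> fm \<Rightarrow> fm" where
  "BEx t \<phi> = Ex (And (Less (Var 0) (shift 1 t)) \<phi>)"

inductive is_Delta0 :: "fm \<Rightarrow> bool" where
  "is_Delta0 (Eq s t)"
| "is_Delta0 (Less s t)"
| "is_Delta0 Bot"
| "is_Delta0 \<phi> \<Longrightarrow> is_Delta0 \<psi> \<Longrightarrow> is_Delta0 (Imp \<phi> \<psi>)"
| "is_Delta0 \<phi> \<Longrightarrow> is_Delta0 (BAll t \<phi>)"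
| "is_Delta0 \<phi> \<Longrightarrow> is_Delta0 (BEx t \<phi>)"

inductive is_Sigma :: "nat \<Rightarrow> fm \<Rightarrow> bool" and is_Pi :: "nat \<Rightarrow> fm \<Rightarrow> bool" where
  "is_Delta0 \<phi> \<Longrightarrow> is_Sigma 0 \<phi>"
| "is_Delta0 \<phi> \<Longrightarrow> is_Pi 0 \<phi>"
| "is_Pi n \<phi> \<Longrightarrow> is_Sigma (Suc n) ((Ex ^^ k) \<phi>)"
| "is_Sigma n \<phi> \<Longrightarrow> is_Pi (Suc n) ((All ^^ k) \<phi>)"

definition is_Delta_over :: "fm set \<Rightarrow> nat \<Rightarrow> fm \<Rightarrow> bool" where
  "is_Delta_over T n \<phi> \<longleftrightarrow>
     (\<exists>\<sigma>. sentence \<sigma> \<and> is_Sigma n \<sigma> \<and> T \<turnstile> Iff \<phi> \<sigma>) \<and>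
     (\<exists>\<pi>. sentence \<pi> \<and> is_Pi n \<pi> \<and> T \<turnstile> Iff \<phi> \<pi>)"

text \<open>
  Peano arithmetic without induction: the theory of the non-negative parts of discretely
  ordered rings. Below, \<open>Var 0\<close>, \<open>Var 1\<close>, \<open>Var 2\<close> play the roles of \<open>x\<close>, \<open>y\<close>, \<open>z\<close>.
\<close>

definition Pminus :: "fm set" where
  "Pminus = univ_closure ` {
     Eq (Add (Add (Var 0) (Var 1)) (Var 2)) (Add (Var 0) (Add (Var 1) (Var 2))),
     Eq (Add (Var 0) (Var 1)) (Add (Var 1) (Var 0)),
     Eq (Mul (Mul (Var 0) (Var 1)) (Var 2)) (Mul (Var 0) (Mul (Var 1) (Var 2))),
     Eq (Mul (Var 0) (Var 1)) (Mul (Var 1) (Var 0)),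
     Eq (Mul (Var 0) (Add (Var 1) (Var 2))) (Add (Mul (Var 0) (Var 1)) (Mul (Var 0) (Var 2))),
     Eq (Add (Var 0) Zero) (Var 0),
     Eq (Mul (Var 0) Zero) Zero,
     Eq (Mul (Var 0) One) (Var 0),
     Imp (And (Less (Var 0) (Var 1)) (Less (Var 1) (Var 2))) (Less (Var 0) (Var 2)),
     Neg (Less (Var 0) (Var 0)),
     Or (Less (Var 0) (Var 1)) (Or (Eq (Var 0) (Var 1)) (Less (Var 1) (Var 0))),
     Imp (Less (Var 0) (Var 1)) (Less (Add (Var 0) (Var 2)) (Add (Var 1) (Var 2))),
     Imp (And (Less Zero (Var 2)) (Less (Var 0) (Var 1)))
         (Less (Mul (Var 0) (Var 2)) (Mul (Var 1) (Var 2))),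
     Imp (Less (Var 0) (Var 1)) (Ex (Eq (Add (Var 1) (Var 0)) (Var 2))),
     Less Zero One,
     Imp (Less Zero (Var 0)) (Leq One (Var 0)),
     Leq Zero (Var 0)}"

text \<open>In \<open>Ind \<phi>\<close> the induction variable is \<open>Var 0\<close>; all other variables are parameters.\<close>

definition Ind :: "fm \<Rightarrow> fm" where
  "Ind \<phi> = Imp (And (inst [Zero] 0 \<phi>) (All (Imp \<phi> (inst [Add (Var 0) One] 1 \<phi>)))) (All \<phi>)"

definition ISigma1 :: "fm set" where
  "ISigma1 = Pminus \<union> {univ_closure (Ind \<phi>) |\<phi>. is_Sigma 1 \<phi>}"

text \<open>
  Sequence coding: with the Cantor pairing \<open>\<langle>x,y\<rangle> = (x+y)(x+y+1)/2 + y\<close>, the number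
  \<open>s = \<langle>\<langle>a,b\<rangle>,l\<rangle>\<close> codes the sequence of length \<open>l\<close> whose entry at \<open>i < l\<close> is the value
  \<open>a mod (1 + (i+1)b)\<close> of Goedel's beta function. As the pairing is onto, every number codes
  a finite sequence. All the formulas here are \<open>\<Delta>\<^sub>0\<close>.
\<close>

definition Succ :: "tm \<Rightarrow> tm" where
  "Succ t = Add t One"

definition pair_fm :: "tm \<Rightarrow> tm \<Rightarrow> tm \<Rightarrow> fm" where
  "pair_fm x y z =
     Eq (Add (Mul (Add x y) (Succ (Add x y))) (Add y y)) (Add z z)"

definition lth_fm :: "tm \<Rightarrow> tm \<Rightarrow> fm" where
  "lth_fm s l = BEx (Succ s) (pair_fm (Var 0) (shift 1 l) (shift 1 s))"

text \<open>
  In \<open>entry_fm s i r\<close>, expressing \<open>(s)\<^sub>i = r\<close>, the bound variables are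
  \<open>p = \<langle>a,b\<rangle>\<close>, \<open>l\<close>, \<open>a\<close>, \<open>b\<close> and the quotient \<open>q\<close>, i.e. \<open>Var 4\<close> down to \<open>Var 0\<close>.
\<close>

definition entry_fm :: "tm \<Rightarrow> tm \<Rightarrow> tm \<Rightarrow> fm" where
  "entry_fm s i r =
     BEx (Succ s) (BEx (Succ (shift 1 s)) (BEx (Succ (Var 1)) (BEx (Succ (Var 2))
       (BEx (Succ (Var 1))
         (let m = Succ (Mul (Succ (shift 5 i)) (Var 1)) in
          And (pair_fm (Var 4) (Var 3) (shift 5 s))
         (And (pair_fm (Var 2) (Var 1) (Var 4))
         (And (Eq (Var 2) (Add (Mul (Var 0) m) (shift 5 r)))
              (Less (shift 5 r) m))))))))"

text \<open>
  In \<open>\<phi>(x,y)\<close>, \<open>x\<close> is \<open>Var 0\<close>, \<open>y\<close> is \<open>Var 1\<close>, and the parameters start at \<open>Var 2\<close>.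
  In \<open>PFUN\<close> the quantified variables are \<open>x\<close>, \<open>y\<close>, \<open>y'\<close>, in this order.
\<close>

definition PFUN :: "fm \<Rightarrow> fm" where
  "PFUN \<phi> = All (All (All
     (Imp (And (inst [Var 2, Var 1] 3 \<phi>) (inst [Var 2, Var 0] 3 \<phi>)) (Eq (Var 1) (Var 0)))))"

text \<open>
  The quantified variables of \<open>Approx\<close> are \<open>i\<close>, \<open>x\<close>, \<open>y\<close>, \<open>l = lth(s)\<close>, \<open>u = (s)\<^sub>i\<close>,
  \<open>v = (s)\<^sub>i\<^sub>+\<^sub>1\<close>, in this order, i.e. \<open>Var 5\<close> down to \<open>Var 0\<close>; the
  condition \<open>i < lth(s) - 1\<close> is rendered as \<open>i + 1 < lth(s)\<close>. The argument \<open>k\<close> is the index of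
  the first parameter of \<open>\<phi>\<close> at the place where the formula is used.
\<close>

definition Approx :: "nat \<Rightarrow> fm \<Rightarrow> tm \<Rightarrow> fm" where
  "Approx k \<phi> s = (All ^^ 6)
     (Imp (And (lth_fm (shift 6 s) (Var 2))
          (And (Less (Succ (Var 5)) (Var 2))
          (And (entry_fm (shift 6 s) (Var 5) (Var 1))
          (And (entry_fm (shift 6 s) (Succ (Var 5)) (Var 0))
          (And (Leq (Var 4) (Var 1))
               (inst [Var 4, Var 3] (k + 6) \<phi>))))))
     (Leq (Var 3) (Var 0)))"

definition P_axiom :: "fm \<Rightarrow> fm" where
  "P_axiom \<phi> =
     Imp (PFUN \<phi>) (All (Ex (And (Approx 2 \<phi> (Var 0)) (lth_fm (Var 0) (Var 1)))))"

definition PSigma1 :: "fm set" where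
  "PSigma1 = ISigma1 \<union> {univ_closure (P_axiom \<phi>) |\<phi>. is_Sigma 1 \<phi>}"

end

(*
  Upper bound: pulling quantifiers out of the axioms of I-Sigma-1 and of P phi for phi in Sigma-1
  gives equivalent Pi-3 formulas; no collection is needed.

  Lower bound: every Sigma-3 consequence of P-Sigma-1 is true in the standard model, so a theory
  axiomatized by such sentences holds in any model of Pminus and of the true Sigma-3 sentences.
  Such a model is the restricted ultrapower of total computable functions modulo a free ultrafilter:
  as bounded search is computable, Los' theorem holds for Delta-0 formulas, and witnesses of true
  Pi-2 sentences are found by unbounded search. Each element of this model is the value of a
  standard program at the element id, so P phi fails in it for the universal Sigma-1 function phi.
*)

theory Submission
  imports Defs "HOL-Library.Nat_Bijection" "HOL-Number_Theory.Cong"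
begin

subsection \<open>Natural deduction\<close>

text \<open>\<open>same_theorems\<close> compares provability, so for the upper bound the prenex
  forms are derived inside the calculus; models serve only the lower bound. There the obstacle is
  that every witness must be a total computable function. Bounded quantifiers therefore have to be
  decided, and an unbounded search has to halt at every index; this is why transfer beyond \<Delta>0
  starts from truth at all indices rather than at almost all of them. The universal relation takes
  the program as \<open>x\<close>, the output as \<open>y\<close> and the input as a parameter. Its
  functionality is then a true Pi_1 statement, which the ultrapower inherits, and with the input
  fixed at \<open>id\<close> one step of an approximation bounds the values at \<open>id\<close> of
  all programs up to a given element. Two such steps, at standard indices, already contradict the
  choice of the model. The Delta_3 claim reduces to the Sigma_3 claim because \<open>Pminus\<close>
  holds in both structures, so that formulas equivalent over \<open>Pminus\<close> have the same
  truth value in each.\<close>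

lemma substt_substt: "substt \<sigma> (substt \<tau> t) = substt (\<lambda>n. substt \<sigma> (\<tau> n)) t"
  by (induction t) auto

lemma subst_subst: "subst \<sigma> (subst \<tau> \<phi>) = subst (\<lambda>n. substt \<sigma> (\<tau> n)) \<phi>"
proof (induction \<phi> arbitrary: \<sigma> \<tau>)
  case (All \<phi>)
  show ?case
    unfolding subst.simps All.IH
    by (intro arg_cong[where f = All] arg_cong2[where f = subst] ext)
      (simp_all add: shift_def substt_substt split: nat.split)
qed (simp_all add: substt_substt)

lemma substt_Var: "substt Var t = t"
  by (induction t) auto

lemma subst_Var: "subst Var \<phi> = \<phi>"
proof (induction \<phi>)
  case (All \<phi>)
  have "case_nat (Var 0) (\<lambda>n. shift 1 (Var n)) = Var"
    by (rule ext) (simp add: shift_def split: nat.split)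
  with All show ?case by simp
qed (simp_all add: substt_Var)

lemma substt_cong: "(\<And>n. n < fvbt t \<Longrightarrow> \<sigma> n = \<tau> n) \<Longrightarrow> substt \<sigma> t = substt \<tau> t"
  by (induction t) auto

lemma subst_cong: "(\<And>n. n < fvb \<phi> \<Longrightarrow> \<sigma> n = \<tau> n) \<Longrightarrow> subst \<sigma> \<phi> = subst \<tau> \<phi>"
proof (induction \<phi> arbitrary: \<sigma> \<tau>)
  case (Imp \<phi> \<psi>)
  have "subst \<sigma> \<phi> = subst \<tau> \<phi>" "subst \<sigma> \<psi> = subst \<tau> \<psi>"
    by (rule Imp.IH, rule Imp.prems, simp)+
  then show ?case by simp
next
  case (All \<phi>)
  have "subst (case_nat (Var 0) (\<lambda>n. shift 1 (\<sigma> n))) \<phi> = subst (case_nat (Var 0) (\<lambda>n. shift 1 (\<tau> n))) \<phi>"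
  proof (rule All.IH)
    show "case_nat (Var 0) (\<lambda>n. shift 1 (\<sigma> n)) n = case_nat (Var 0) (\<lambda>n. shift 1 (\<tau> n)) n" if "n < fvb \<phi>" for n
      using that All.prems[of "n - 1"] by (cases n) auto
  qed
  then show ?case by simp
next
  case (Eq s t)
  have "substt \<sigma> s = substt \<tau> s" "substt \<sigma> t = substt \<tau> t"
    by (rule substt_cong, rule Eq, simp)+
  then show ?case by simp
next
  case (Less s t)
  have "substt \<sigma> s = substt \<tau> s" "substt \<sigma> t = substt \<tau> t"
    by (rule substt_cong, rule Less, simp)+
  then show ?case by simp
qed simp

lemma subst_sentence: "sentence \<phi> \<Longrightarrow> subst \<sigma> \<phi> = \<phi>"
  using subst_cong[of \<phi> \<sigma> Var] by (simp add: sentence_def subst_Var)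

text \<open>The renaming that \<open>AllI\<close> applies to its hypotheses: with de Bruijn indices
  it takes the place of the eigenvariable condition.\<close>

definition lift :: "fm \<Rightarrow> fm" where
  "lift = subst (\<lambda>n. Var (Suc n))"

lemma inst_Nil_1: "inst [] 1 = lift"
  by (simp add: fun_eq_iff inst_def lift_def)

lemma lift_AllI: "lift ` \<Gamma> \<turnstile> \<phi> \<Longrightarrow> \<Gamma> \<turnstile> All \<phi>"
  by (rule AllI) (simp only: inst_Nil_1)

lemma inst_single: "inst [t] 0 \<phi> = subst (case_nat t Var) \<phi>"
  unfolding inst_def by (rule arg_cong2[where f = subst]) (auto simp: fun_eq_iff split: nat.split)

lemma lift_simps [simp]:
  "lift Bot = Bot"
  "lift (Imp \<phi> \<psi>) = Imp (lift \<phi>) (lift \<psi>)"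
  "lift (Neg \<phi>) = Neg (lift \<phi>)"
  by (simp_all add: lift_def Neg_def)

lemma lift_sentence: "sentence \<phi> \<Longrightarrow> lift \<phi> = \<phi>"
  by (simp add: lift_def subst_sentence)

lemma inst_single_simps [simp]:
  "inst [t] 0 (lift \<phi>) = \<phi>"
  "inst [t] 0 (Imp \<phi> \<psi>) = Imp (inst [t] 0 \<phi>) (inst [t] 0 \<psi>)"
  "inst [t] 0 (Neg \<phi>) = Neg (inst [t] 0 \<phi>)"
  by (simp_all add: lift_def inst_single subst_subst subst_Var Neg_def)

lemma weaken: "\<Gamma> \<turnstile> \<phi> \<Longrightarrow> \<Gamma> \<subseteq> \<Delta> \<Longrightarrow> \<Delta> \<turnstile> \<phi>"
proof (induction arbitrary: \<Delta> rule: proves.induct)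
  case (Assm \<phi> \<Gamma>)
  then show ?case by (meson proves.Assm subsetD)
next
  case (ImpI \<phi> \<Gamma> \<psi>)
  then show ?case by (meson insert_mono proves.ImpI)
next
  case (ImpE \<Gamma> \<phi> \<psi>)
  show ?case by (rule proves.ImpE[OF ImpE.IH(1)[OF ImpE.prems] ImpE.IH(2)[OF ImpE.prems]])
next
  case (Contr \<phi> \<Gamma>)
  then show ?case by (meson insert_mono proves.Contr)
next
  case (AllI \<Gamma> \<phi>)
  then show ?case by (meson image_mono proves.AllI)
next
  case (AllE \<Gamma> \<phi> t)
  show ?case by (rule proves.AllE[OF AllE.IH[OF AllE.prems]])
next
  case (EqRefl \<Gamma> t)
  show ?case by (rule proves.EqRefl)
next
  case (EqSubst \<Gamma> s t \<phi>)
  show ?case by (rule proves.EqSubst[OF EqSubst.IH(1)[OF EqSubst.prems] EqSubst.IH(2)[OF EqSubst.prems]])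
qed

lemma weaken_insert: "\<Gamma> \<turnstile> \<phi> \<Longrightarrow> insert \<psi> \<Gamma> \<turnstile> \<phi>"
  by (erule weaken) auto

lemma cut: "\<Gamma> \<turnstile> \<psi> \<Longrightarrow> insert \<psi> \<Gamma> \<turnstile> \<phi> \<Longrightarrow> \<Gamma> \<turnstile> \<phi>"
  by (rule ImpE[OF ImpI])

lemma finite_support: "\<Gamma> \<turnstile> \<phi> \<Longrightarrow> \<exists>\<Delta>\<subseteq>\<Gamma>. finite \<Delta> \<and> \<Delta> \<turnstile> \<phi>"
proof (induction rule: proves.induct)
  case (Assm \<phi> \<Gamma>)
  then show ?case
    by (intro exI[of _ "{\<phi>}"]) (simp add: proves.Assm)
next
  case (ImpI \<phi> \<Gamma> \<psi>)
  then obtain \<Delta> where \<Delta>: "\<Delta> \<subseteq> insert \<phi> \<Gamma>" "finite \<Delta>" "\<Delta> \<turnstile> \<psi>" by blast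
  have "\<Delta> - {\<phi>} \<turnstile> Imp \<phi> \<psi>"
    by (rule proves.ImpI, rule weaken[OF \<Delta>(3)]) auto
  with \<Delta> show ?case by (intro exI[of _ "\<Delta> - {\<phi>}"]) auto
next
  case (ImpE \<Gamma> \<phi> \<psi>)
  then obtain \<Delta> \<Delta>' where \<Delta>: "\<Delta> \<union> \<Delta>' \<subseteq> \<Gamma>" "finite (\<Delta> \<union> \<Delta>')" "\<Delta> \<turnstile> Imp \<phi> \<psi>" "\<Delta>' \<turnstile> \<phi>"
    by auto
  have "\<Delta> \<union> \<Delta>' \<turnstile> \<psi>"
    by (rule proves.ImpE[OF weaken[OF \<Delta>(3)] weaken[OF \<Delta>(4)]]) auto
  with \<Delta>(1,2) show ?case by (intro exI[of _ "\<Delta> \<union> \<Delta>'"] conjI)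
next
  case (Contr \<phi> \<Gamma>)
  then obtain \<Delta> where \<Delta>: "\<Delta> \<subseteq> insert (Neg \<phi>) \<Gamma>" "finite \<Delta>" "\<Delta> \<turnstile> Bot" by blast
  have "\<Delta> - {Neg \<phi>} \<turnstile> \<phi>"
    by (rule proves.Contr, rule weaken[OF \<Delta>(3)]) auto
  with \<Delta> show ?case by (intro exI[of _ "\<Delta> - {Neg \<phi>}"]) auto
next
  case (AllI \<Gamma> \<phi>)
  then obtain \<Delta> where "\<Delta> \<subseteq> inst [] 1 ` \<Gamma>" "finite \<Delta>" "\<Delta> \<turnstile> \<phi>" by blast
  then show ?case by (metis finite_subset_image proves.AllI)
next
  case (AllE \<Gamma> \<phi> t)
  then show ?case by (blast intro: proves.AllE)
next
  case (EqRefl \<Gamma> t)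
  show ?case by (intro exI[of _ "{}"]) (simp add: proves.EqRefl)
next
  case (EqSubst \<Gamma> s t \<phi>)
  then obtain \<Delta> \<Delta>' where \<Delta>: "\<Delta> \<union> \<Delta>' \<subseteq> \<Gamma>" "finite (\<Delta> \<union> \<Delta>')" "\<Delta> \<turnstile> Eq s t" "\<Delta>' \<turnstile> inst [s] 0 \<phi>"
    by auto
  have "\<Delta> \<union> \<Delta>' \<turnstile> inst [t] 0 \<phi>"
    by (rule proves.EqSubst[OF weaken[OF \<Delta>(3)] weaken[OF \<Delta>(4)]]) auto
  with \<Delta>(1,2) show ?case by (intro exI[of _ "\<Delta> \<union> \<Delta>'"] conjI)
qed

text \<open>A cut removes one hypothesis at a time, so \<open>finite_support\<close> first replaces
  the possibly infinite \<open>\<Gamma>\<close> by a finite subset. This serves infinite theories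
  such as \<open>PSigma1\<close>.\<close>

lemma cut_set:
  assumes "\<Gamma> \<turnstile> \<phi>" and "\<And>\<psi>. \<psi> \<in> \<Gamma> \<Longrightarrow> \<Delta> \<turnstile> \<psi>"
  shows "\<Delta> \<turnstile> \<phi>"
proof -
  obtain \<Gamma>' where \<Gamma>': "\<Gamma>' \<subseteq> \<Gamma>" "finite \<Gamma>'" "\<Gamma>' \<turnstile> \<phi>"
    using finite_support[OF assms(1)] by blast
  have "\<Gamma>' \<union> \<Delta> \<turnstile> \<phi>"
    using \<Gamma>'(3) by (rule weaken) auto
  with \<Gamma>'(2,1) show ?thesis
  proof (induction rule: finite_induct)
    case (insert \<psi> \<Theta>)
    have "\<Theta> \<union> \<Delta> \<turnstile> \<psi>"
      using assms(2) insert.prems(1) by (auto intro: weaken)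
    with insert.prems(2) have "\<Theta> \<union> \<Delta> \<turnstile> \<phi>"
      by (auto intro: cut)
    with insert show ?case by auto
  qed simp
qed

lemma Bot_E: "\<Gamma> \<turnstile> Bot \<Longrightarrow> \<Gamma> \<turnstile> \<phi>"
  by (rule Contr, erule weaken_insert)

lemma Neg_I: "insert \<phi> \<Gamma> \<turnstile> Bot \<Longrightarrow> \<Gamma> \<turnstile> Neg \<phi>"
  unfolding Neg_def by (rule ImpI)

lemma Neg_E: "\<Gamma> \<turnstile> Neg \<phi> \<Longrightarrow> \<Gamma> \<turnstile> \<phi> \<Longrightarrow> \<Gamma> \<turnstile> \<psi>"
  unfolding Neg_def by (blast intro: ImpE Bot_E)

lemma Imp_Assm: "Imp \<phi> \<psi> \<in> \<Gamma> \<Longrightarrow> \<phi> \<in> \<Gamma> \<Longrightarrow> \<Gamma> \<turnstile> \<psi>"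
  by (rule ImpE[OF Assm Assm])

lemma Neg_Assm: "Neg \<phi> \<in> \<Gamma> \<Longrightarrow> \<phi> \<in> \<Gamma> \<Longrightarrow> \<Gamma> \<turnstile> \<psi>"
  by (rule Neg_E[OF Assm Assm])

text \<open>Instantiating the lifted quantifier at \<open>Var 0\<close> undoes the lifting, so the
  bound variable becomes the fresh variable of the context.\<close>

lemma lift_All_E: "\<Gamma> \<turnstile> lift (All \<phi>) \<Longrightarrow> \<Gamma> \<turnstile> \<phi>"
proof -
  have "inst [Var 0] 0 (subst (case_nat (Var 0) (\<lambda>n. shift 1 (Var (Suc n)))) \<phi>) = subst Var \<phi>"
    unfolding inst_single subst_subst
    by (rule subst_cong) (simp add: shift_def split: nat.split)
  moreover assume "\<Gamma> \<turnstile> lift (All \<phi>)"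
  ultimately show ?thesis
    by (metis AllE lift_def subst.simps(5) subst_Var)
qed

lemma All_elim: "All \<phi> \<in> \<Gamma> \<Longrightarrow> lift ` \<Gamma> \<turnstile> \<phi>"
  by (rule lift_All_E, rule Assm) simp

lemma lift_Ex_I: "\<Gamma> \<turnstile> \<phi> \<Longrightarrow> \<Gamma> \<turnstile> lift (Ex \<phi>)"
proof -
  assume *: "\<Gamma> \<turnstile> \<phi>"
  have "insert (lift (All (Neg \<phi>))) \<Gamma> \<turnstile> Neg \<phi>"
    by (rule lift_All_E, rule Assm) simp
  with * show ?thesis
    unfolding Ex_def lift_simps by (intro Neg_I) (rule Neg_E[OF _ weaken_insert])
qed

text \<open>As \<open>Ex\<close> abbreviates a negated universal, the rule is derived by refuting
  \<open>Neg \<psi>\<close>: under it, every witness of \<open>\<phi>\<close> leads to a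
  contradiction.\<close>

lemma Ex_E:
  assumes "\<Gamma> \<turnstile> Ex \<phi>" and "insert \<phi> (lift ` \<Gamma>) \<turnstile> lift \<psi>"
  shows "\<Gamma> \<turnstile> \<psi>"
proof -
  have "insert \<phi> (lift ` insert (Neg \<psi>) \<Gamma>) \<turnstile> Neg (lift \<psi>)"
    by (rule Assm) simp
  moreover have "insert \<phi> (lift ` insert (Neg \<psi>) \<Gamma>) \<turnstile> lift \<psi>"
    using assms(2) by (rule weaken) auto
  ultimately have "insert (Neg \<psi>) \<Gamma> \<turnstile> All (Neg \<phi>)"
    by (intro lift_AllI Neg_I) (rule Neg_E)
  moreover have "insert (Neg \<psi>) \<Gamma> \<turnstile> Neg (All (Neg \<phi>))"
    using weaken_insert[OF assms(1)] by (simp add: Ex_def)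
  ultimately show ?thesis
    by - (rule Contr, rule Neg_E)
qed

section \<open>Provable equivalence, and quantifiers pulled out of an implication\<close>

definition eqv :: "fm \<Rightarrow> fm \<Rightarrow> bool" where
  "eqv \<phi> \<psi> \<longleftrightarrow> {\<phi>} \<turnstile> \<psi> \<and> {\<psi>} \<turnstile> \<phi>"

lemma eqv_refl: "eqv \<phi> \<phi>"
  by (simp add: eqv_def Assm)

lemma eqv_trans: "eqv \<phi> \<psi> \<Longrightarrow> eqv \<psi> \<chi> \<Longrightarrow> eqv \<phi> \<chi>"
  unfolding eqv_def by (metis cut_set singletonD)

lemma eqv_sym: "eqv \<phi> \<psi> \<Longrightarrow> eqv \<psi> \<phi>"
  by (simp add: eqv_def)

lemma eqv_D: "eqv \<phi> \<psi> \<Longrightarrow> \<Gamma> \<turnstile> \<phi> \<Longrightarrow> \<Gamma> \<turnstile> \<psi>"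
  unfolding eqv_def by (metis cut_set singletonD)

lemma eqv_Imp:
  assumes "eqv \<phi> \<phi>'" "eqv \<psi> \<psi>'"
  shows "eqv (Imp \<phi> \<psi>) (Imp \<phi>' \<psi>')"
proof -
  have *: "{Imp \<phi> \<psi>} \<turnstile> Imp \<phi>' \<psi>'" if "eqv \<phi>' \<phi>" "eqv \<psi> \<psi>'" for \<phi> \<phi>' \<psi> \<psi>'
  proof (rule ImpI)
    have "{\<phi>', Imp \<phi> \<psi>} \<turnstile> \<phi>"
      by (rule eqv_D[OF that(1)], rule Assm) simp
    then have "{\<phi>', Imp \<phi> \<psi>} \<turnstile> \<psi>"
      by (rule ImpE[rotated]) (rule Assm, simp)
    then show "{\<phi>', Imp \<phi> \<psi>} \<turnstile> \<psi>'"
      by (rule eqv_D[OF that(2)])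
  qed
  show ?thesis
    using *[OF eqv_sym[OF assms(1)] assms(2)] *[OF assms(1) eqv_sym[OF assms(2)]]
    unfolding eqv_def by (rule conjI)
qed

lemma eqv_All:
  assumes "eqv \<phi> \<psi>"
  shows "eqv (All \<phi>) (All \<psi>)"
proof -
  have *: "{All \<phi>} \<turnstile> All \<psi>" if "eqv \<phi> \<psi>" for \<phi> \<psi>
    by (rule lift_AllI, rule eqv_D[OF that], rule All_elim) simp
  show ?thesis
    using *[OF assms] *[OF eqv_sym[OF assms]] unfolding eqv_def by (rule conjI)
qed

lemma eqv_Ex: "eqv \<phi> \<psi> \<Longrightarrow> eqv (Ex \<phi>) (Ex \<psi>)"
  unfolding Ex_def Neg_def by (rule eqv_Imp[OF eqv_All[OF eqv_Imp[OF _ eqv_refl]] eqv_refl])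

lemma eqv_Imp_All: "eqv (Imp \<phi> (All \<psi>)) (All (Imp (lift \<phi>) \<psi>))"
  unfolding eqv_def
proof (intro conjI)
  show "{Imp \<phi> (All \<psi>)} \<turnstile> All (Imp (lift \<phi>) \<psi>)"
  proof (intro lift_AllI ImpI)
    show "insert (lift \<phi>) (lift ` {Imp \<phi> (All \<psi>)}) \<turnstile> \<psi>"
      by (rule lift_All_E, rule Imp_Assm[of "lift \<phi>"]) simp_all
  qed
  show "{All (Imp (lift \<phi>) \<psi>)} \<turnstile> Imp \<phi> (All \<psi>)"
  proof (intro lift_AllI ImpI)
    have "lift ` {\<phi>, All (Imp (lift \<phi>) \<psi>)} \<turnstile> Imp (lift \<phi>) \<psi>"
      by (rule All_elim) simp
    then show "lift ` {\<phi>, All (Imp (lift \<phi>) \<psi>)} \<turnstile> \<psi>"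
      by (rule ImpE) (rule Assm, simp)
  qed
qed

lemma eqv_Imp_Ex: "eqv (Imp \<phi> (Ex \<psi>)) (Ex (Imp (lift \<phi>) \<psi>))"
  unfolding eqv_def
proof (intro conjI)
  let ?H = "All (Neg (Imp (lift \<phi>) \<psi>))"
  let ?\<Gamma> = "{?H, Imp \<phi> (Ex \<psi>)}"
  \<comment> \<open>Any term would do as a witness: it matters only in the case that
    \<open>\<phi>\<close> fails, where the implication holds vacuously.\<close>
  have inst: "insert \<chi> ?\<Gamma> \<turnstile> Neg (Imp \<phi> (inst [Zero] 0 \<psi>))" for \<chi>
    using AllE[of "insert \<chi> ?\<Gamma>" "Neg (Imp (lift \<phi>) \<psi>)" Zero] by (simp add: Assm)
  have "insert (Neg \<phi>) ?\<Gamma> \<turnstile> Imp \<phi> (inst [Zero] 0 \<psi>)"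
    by (rule ImpI, rule Neg_Assm[of \<phi>]) simp_all
  with inst have "?\<Gamma> \<turnstile> \<phi>"
    by - (rule Contr, rule Neg_E)
  then have ex: "?\<Gamma> \<turnstile> Ex \<psi>"
    by (rule ImpE[rotated]) (rule Assm, simp)
  have "insert \<psi> (lift ` ?\<Gamma>) \<turnstile> lift Bot"
  proof (rule Neg_E)
    show "insert \<psi> (lift ` ?\<Gamma>) \<turnstile> Neg (Imp (lift \<phi>) \<psi>)"
      by (rule weaken_insert, rule All_elim) simp
    show "insert \<psi> (lift ` ?\<Gamma>) \<turnstile> Imp (lift \<phi>) \<psi>"
      by (rule ImpI, rule Assm) simp
  qed
  with ex have "?\<Gamma> \<turnstile> Bot"
    by (rule Ex_E)
  then show "{Imp \<phi> (Ex \<psi>)} \<turnstile> Ex (Imp (lift \<phi>) \<psi>)"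
    unfolding Ex_def by (rule Neg_I)
next
  show "{Ex (Imp (lift \<phi>) \<psi>)} \<turnstile> Imp \<phi> (Ex \<psi>)"
  proof (rule ImpI, rule Ex_E)
    show "{\<phi>, Ex (Imp (lift \<phi>) \<psi>)} \<turnstile> Ex (Imp (lift \<phi>) \<psi>)"
      by (rule Assm) simp
    show "insert (Imp (lift \<phi>) \<psi>) (lift ` {\<phi>, Ex (Imp (lift \<phi>) \<psi>)}) \<turnstile> lift (Ex \<psi>)"
      by (rule lift_Ex_I, rule Imp_Assm[of "lift \<phi>"]) simp_all
  qed
qed

lemma eqv_Ex_Imp: "eqv (Imp (Ex \<phi>) \<psi>) (All (Imp \<phi> (lift \<psi>)))"
  unfolding eqv_def
proof (intro conjI)
  show "{Imp (Ex \<phi>) \<psi>} \<turnstile> All (Imp \<phi> (lift \<psi>))"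
  proof (intro lift_AllI ImpI, rule ImpE)
    show "insert \<phi> (lift ` {Imp (Ex \<phi>) \<psi>}) \<turnstile> Imp (lift (Ex \<phi>)) (lift \<psi>)"
      by (rule Assm) simp
    show "insert \<phi> (lift ` {Imp (Ex \<phi>) \<psi>}) \<turnstile> lift (Ex \<phi>)"
      by (rule lift_Ex_I, rule Assm) simp
  qed
  show "{All (Imp \<phi> (lift \<psi>))} \<turnstile> Imp (Ex \<phi>) \<psi>"
  proof (rule ImpI, rule Ex_E)
    let ?\<Gamma> = "{Ex \<phi>, All (Imp \<phi> (lift \<psi>))}"
    show "?\<Gamma> \<turnstile> Ex \<phi>"
      by (rule Assm) simp
    have "insert \<phi> (lift ` ?\<Gamma>) \<turnstile> Imp \<phi> (lift \<psi>)"
      by (rule weaken_insert, rule All_elim) simp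
    then show "insert \<phi> (lift ` ?\<Gamma>) \<turnstile> lift \<psi>"
      by (rule ImpE) (rule Assm, simp)
  qed
qed

text \<open>A classical argument: if \<open>\<phi>\<close> fails somewhere, that point is a witness;
  otherwise \<open>\<psi>\<close> follows, and any point, here \<open>Zero\<close>, is one.\<close>

lemma eqv_All_Imp: "eqv (Imp (All \<phi>) \<psi>) (Ex (Imp \<phi> (lift \<psi>)))"
  unfolding eqv_def
proof (intro conjI)
  let ?H = "All (Neg (Imp \<phi> (lift \<psi>)))"
  let ?\<Gamma> = "{?H, Imp (All \<phi>) \<psi>}"
  have "insert (Neg \<phi>) (lift ` ?\<Gamma>) \<turnstile> Bot"
  proof (rule Neg_E)
    show "insert (Neg \<phi>) (lift ` ?\<Gamma>) \<turnstile> Neg (Imp \<phi> (lift \<psi>))"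
      by (rule weaken_insert, rule All_elim) simp
    show "insert (Neg \<phi>) (lift ` ?\<Gamma>) \<turnstile> Imp \<phi> (lift \<psi>)"
      by (rule ImpI, rule Neg_Assm[of \<phi>]) simp_all
  qed
  then have "?\<Gamma> \<turnstile> All \<phi>"
    by (rule lift_AllI[OF Contr])
  then have "?\<Gamma> \<turnstile> \<psi>"
    by (rule ImpE[rotated]) (rule Assm, simp)
  then have "?\<Gamma> \<turnstile> Imp (inst [Zero] 0 \<phi>) \<psi>"
    by (rule ImpI[OF weaken_insert])
  moreover have "?\<Gamma> \<turnstile> Neg (Imp (inst [Zero] 0 \<phi>) \<psi>)"
    using AllE[of ?\<Gamma> "Neg (Imp \<phi> (lift \<psi>))" Zero] by (simp add: Assm)
  ultimately show "{Imp (All \<phi>) \<psi>} \<turnstile> Ex (Imp \<phi> (lift \<psi>))"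
    unfolding Ex_def by - (rule Neg_I, rule Neg_E)
next
  show "{Ex (Imp \<phi> (lift \<psi>))} \<turnstile> Imp (All \<phi>) \<psi>"
  proof (rule ImpI, rule Ex_E)
    let ?\<Gamma> = "{All \<phi>, Ex (Imp \<phi> (lift \<psi>))}"
    show "?\<Gamma> \<turnstile> Ex (Imp \<phi> (lift \<psi>))"
      by (rule Assm) simp
    have "insert (Imp \<phi> (lift \<psi>)) (lift ` ?\<Gamma>) \<turnstile> \<phi>"
      by (rule weaken_insert, rule All_elim) simp
    then show "insert (Imp \<phi> (lift \<psi>)) (lift ` ?\<Gamma>) \<turnstile> lift \<psi>"
      by (rule ImpE[rotated]) (rule Assm, simp)
  qed
qed

subsection \<open>Prenex forms\<close>

lemma subst_derived [simp]:
  "subst \<sigma> (Neg \<phi>) = Neg (subst \<sigma> \<phi>)"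
  "subst \<sigma> (And \<phi> \<psi>) = And (subst \<sigma> \<phi>) (subst \<sigma> \<psi>)"
  "subst \<sigma> (Ex \<phi>) = Ex (subst (case_nat (Var 0) (\<lambda>n. shift 1 (\<sigma> n))) \<phi>)"
  by (simp_all add: Neg_def And_def Ex_def)

lemma substt_up_shift: "substt (case_nat (Var 0) (\<lambda>n. shift 1 (\<sigma> n))) (shift 1 t) = shift 1 (substt \<sigma> t)"
  by (simp add: shift_def substt_substt)

lemma is_Delta0_subst: "is_Delta0 \<phi> \<Longrightarrow> is_Delta0 (subst \<sigma> \<phi>)"
proof (induction arbitrary: \<sigma> rule: is_Delta0.induct)
  case (5 \<phi> t)
  have "subst \<sigma> (BAll t \<phi>) = BAll (substt \<sigma> t) (subst (case_nat (Var 0) (\<lambda>n. shift 1 (\<sigma> n))) \<phi>)"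
    unfolding BAll_def subst.simps substt.simps substt_up_shift by simp
  with 5 show ?case
    by (simp only: is_Delta0.intros(5))
next
  case (6 \<phi> t)
  have "subst \<sigma> (BEx t \<phi>) = BEx (substt \<sigma> t) (subst (case_nat (Var 0) (\<lambda>n. shift 1 (\<sigma> n))) \<phi>)"
    unfolding BEx_def subst_derived subst.simps substt.simps substt_up_shift by simp
  with 6 show ?case
    by (simp only: is_Delta0.intros(6))
qed (auto intro: is_Delta0.intros)

lemma subst_All_pow: "\<exists>\<tau>. subst \<sigma> ((All ^^ k) \<phi>) = (All ^^ k) (subst \<tau> \<phi>)"
  by (induction k arbitrary: \<sigma>) auto

lemma subst_Ex_pow: "\<exists>\<tau>. subst \<sigma> ((Ex ^^ k) \<phi>) = (Ex ^^ k) (subst \<tau> \<phi>)"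
  by (induction k arbitrary: \<sigma>) (simp_all, metis+)

lemma is_Sigma_Pi_subst:
  "is_Sigma n \<phi> \<Longrightarrow> is_Sigma n (subst \<sigma> \<phi>)"
  "is_Pi n \<phi> \<Longrightarrow> is_Pi n (subst \<sigma> \<phi>)"
proof (induction arbitrary: \<sigma> and \<sigma> rule: is_Sigma_is_Pi.inducts)
  case (3 n \<phi> k)
  then show ?case
    by (metis is_Sigma_is_Pi.intros(3) subst_Ex_pow)
next
  case (4 n \<phi> k)
  then show ?case
    by (metis is_Sigma_is_Pi.intros(4) subst_All_pow)
qed (auto intro: is_Sigma_is_Pi.intros is_Delta0_subst)

lemma is_Sigma_Pi_0_iff [simp]:
  "is_Sigma 0 \<phi> \<longleftrightarrow> is_Delta0 \<phi>" "is_Pi 0 \<phi> \<longleftrightarrow> is_Delta0 \<phi>"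
  by (auto intro: is_Sigma_is_Pi.intros elim: is_Sigma.cases is_Pi.cases)

lemma is_Sigma_SucE:
  assumes "is_Sigma (Suc n) \<phi>"
  obtains k \<psi> where "\<phi> = (Ex ^^ k) \<psi>" "is_Pi n \<psi>"
  using assms by (cases rule: is_Sigma.cases) auto

lemma is_Pi_SucE:
  assumes "is_Pi (Suc n) \<phi>"
  obtains k \<psi> where "\<phi> = (All ^^ k) \<psi>" "is_Sigma n \<psi>"
  using assms by (cases rule: is_Pi.cases) auto

text \<open>A quantifier block of length zero gives the inclusion.\<close>

lemma is_Pi_imp_Sigma: "is_Pi n \<phi> \<Longrightarrow> is_Sigma (Suc n) \<phi>"
  using is_Sigma_is_Pi.intros(3)[of n \<phi> 0] by simp

lemma is_Sigma_imp_Pi: "is_Sigma n \<phi> \<Longrightarrow> is_Pi (Suc n) \<phi>"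
  using is_Sigma_is_Pi.intros(4)[of n \<phi> 0] by simp

lemma is_Sigma_Pi_Suc:
  "is_Sigma n \<phi> \<Longrightarrow> is_Sigma (Suc n) \<phi>"
  "is_Pi n \<phi> \<Longrightarrow> is_Pi (Suc n) \<phi>"
proof (induction rule: is_Sigma_is_Pi.inducts)
  case (1 \<phi>)
  then show ?case by (simp add: is_Pi_imp_Sigma)
next
  case (2 \<phi>)
  then show ?case by (simp add: is_Sigma_imp_Pi)
qed (auto intro: is_Sigma_is_Pi.intros)

lemma is_Sigma_Ex: "is_Sigma (Suc n) \<phi> \<Longrightarrow> is_Sigma (Suc n) (Ex \<phi>)"
  by (metis funpow.simps(2) comp_apply is_Sigma_SucE is_Sigma_is_Pi.intros(3))

lemma is_Pi_All: "is_Pi (Suc n) \<phi> \<Longrightarrow> is_Pi (Suc n) (All \<phi>)"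
  by (metis funpow.simps(2) comp_apply is_Pi_SucE is_Sigma_is_Pi.intros(4))

text \<open>The syntactic classes are not closed under \<open>Imp\<close>, so the closure properties
  are stated up to provable equivalence.\<close>

definition eqv_Sigma :: "nat \<Rightarrow> fm \<Rightarrow> bool" where
  "eqv_Sigma n \<phi> \<longleftrightarrow> (\<exists>\<psi>. is_Sigma n \<psi> \<and> eqv \<phi> \<psi>)"

definition eqv_Pi :: "nat \<Rightarrow> fm \<Rightarrow> bool" where
  "eqv_Pi n \<phi> \<longleftrightarrow> (\<exists>\<psi>. is_Pi n \<psi> \<and> eqv \<phi> \<psi>)"

lemma eqv_Sigma_eqv: "eqv \<phi> \<psi> \<Longrightarrow> eqv_Sigma n \<psi> \<Longrightarrow> eqv_Sigma n \<phi>"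
  unfolding eqv_Sigma_def by (blast intro: eqv_trans)

lemma eqv_Pi_eqv: "eqv \<phi> \<psi> \<Longrightarrow> eqv_Pi n \<psi> \<Longrightarrow> eqv_Pi n \<phi>"
  unfolding eqv_Pi_def by (blast intro: eqv_trans)

lemma eqv_Sigma_Ex: "eqv_Sigma (Suc n) \<phi> \<Longrightarrow> eqv_Sigma (Suc n) (Ex \<phi>)"
  unfolding eqv_Sigma_def by (blast intro: eqv_Ex is_Sigma_Ex)

lemma eqv_Pi_All: "eqv_Pi (Suc n) \<phi> \<Longrightarrow> eqv_Pi (Suc n) (All \<phi>)"
  unfolding eqv_Pi_def by (blast intro: eqv_All is_Pi_All)

lemma eqv_Pi_All_pow: "eqv_Pi (Suc n) \<phi> \<Longrightarrow> eqv_Pi (Suc n) ((All ^^ k) \<phi>)"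
  by (induction k) (auto intro: eqv_Pi_All)

lemma eqv_Sigma_Suc: "eqv_Sigma n \<phi> \<Longrightarrow> eqv_Sigma (Suc n) \<phi>"
  and eqv_Pi_Suc: "eqv_Pi n \<phi> \<Longrightarrow> eqv_Pi (Suc n) \<phi>"
  and eqv_Pi_imp_eqv_Sigma: "eqv_Pi n \<phi> \<Longrightarrow> eqv_Sigma (Suc n) \<phi>"
  and eqv_Sigma_imp_eqv_Pi: "eqv_Sigma n \<phi> \<Longrightarrow> eqv_Pi (Suc n) \<phi>"
  unfolding eqv_Sigma_def eqv_Pi_def
  by (blast intro: is_Sigma_Pi_Suc is_Pi_imp_Sigma is_Sigma_imp_Pi)+

lemma is_Sigma_lift: "is_Sigma n \<phi> \<Longrightarrow> is_Sigma n (lift \<phi>)"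
  and is_Pi_lift: "is_Pi n \<phi> \<Longrightarrow> is_Pi n (lift \<phi>)"
  by (simp_all add: lift_def is_Sigma_Pi_subst)

text \<open>The two claims are proved together: stripping the leading blocks of premise and
  conclusion at level \<open>Suc n\<close> leaves an implication of the other kind at level
  \<open>n\<close>. A quantifier that leaves the premise changes its kind, so both blocks join into
  one.\<close>

lemma Imp_prenex:
  "(is_Pi n \<phi> \<longrightarrow> is_Sigma n \<psi> \<longrightarrow> eqv_Sigma n (Imp \<phi> \<psi>)) \<and>
   (is_Sigma n \<phi> \<longrightarrow> is_Pi n \<psi> \<longrightarrow> eqv_Pi n (Imp \<phi> \<psi>))"
proof (induction n arbitrary: \<phi> \<psi>)
  case 0
  then show ?case
    unfolding eqv_Sigma_def eqv_Pi_def by (auto intro: is_Delta0.intros eqv_refl)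
next
  case (Suc n)
  have 1: "eqv_Sigma (Suc n) (Imp \<phi> ((Ex ^^ j) \<psi>))" if "is_Sigma n \<phi>" "is_Pi n \<psi>" for j \<phi> \<psi>
    using that
  proof (induction j arbitrary: \<phi> \<psi>)
    case 0
    then show ?case using Suc.IH eqv_Pi_imp_eqv_Sigma by simp
  next
    case (Suc j)
    have "eqv_Sigma (Suc n) (Ex (Imp (lift \<phi>) ((Ex ^^ j) \<psi>)))"
      by (intro eqv_Sigma_Ex Suc is_Sigma_lift)
    then show ?case
      using eqv_Sigma_eqv[OF eqv_Imp_Ex] by simp
  qed
  have 2: "eqv_Sigma (Suc n) (Imp ((All ^^ k) \<phi>) \<psi>)" if "is_Sigma n \<phi>" "is_Sigma (Suc n) \<psi>" for k \<phi> \<psi>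
    using that
  proof (induction k arbitrary: \<phi> \<psi>)
    case 0
    then show ?case using 1 by (auto elim: is_Sigma_SucE)
  next
    case (Suc k)
    have "eqv_Sigma (Suc n) (Ex (Imp ((All ^^ k) \<phi>) (lift \<psi>)))"
      by (intro eqv_Sigma_Ex Suc is_Sigma_lift)
    then show ?case
      using eqv_Sigma_eqv[OF eqv_All_Imp] by simp
  qed
  have 3: "eqv_Pi (Suc n) (Imp \<phi> ((All ^^ j) \<psi>))" if "is_Pi n \<phi>" "is_Sigma n \<psi>" for j \<phi> \<psi>
    using that
  proof (induction j arbitrary: \<phi> \<psi>)
    case 0
    then show ?case using Suc.IH eqv_Sigma_imp_eqv_Pi by simp
  next
    case (Suc j)
    have "eqv_Pi (Suc n) (All (Imp (lift \<phi>) ((All ^^ j) \<psi>)))"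
      by (intro eqv_Pi_All Suc is_Pi_lift)
    then show ?case
      using eqv_Pi_eqv[OF eqv_Imp_All] by simp
  qed
  have 4: "eqv_Pi (Suc n) (Imp ((Ex ^^ k) \<phi>) \<psi>)" if "is_Pi n \<phi>" "is_Pi (Suc n) \<psi>" for k \<phi> \<psi>
    using that
  proof (induction k arbitrary: \<phi> \<psi>)
    case 0
    then show ?case using 3 by (auto elim: is_Pi_SucE)
  next
    case (Suc k)
    have "eqv_Pi (Suc n) (All (Imp ((Ex ^^ k) \<phi>) (lift \<psi>)))"
      by (intro eqv_Pi_All Suc is_Pi_lift)
    then show ?case
      using eqv_Pi_eqv[OF eqv_Ex_Imp] by simp
  qed
  show ?case
    using 2 4 by (blast elim: is_Pi_SucE is_Sigma_SucE)
qed

lemma eqv_Sigma_Imp: "eqv_Pi n \<phi> \<Longrightarrow> eqv_Sigma n \<psi> \<Longrightarrow> eqv_Sigma n (Imp \<phi> \<psi>)"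
  and eqv_Pi_Imp: "eqv_Sigma n \<phi> \<Longrightarrow> eqv_Pi n \<psi> \<Longrightarrow> eqv_Pi n (Imp \<phi> \<psi>)"
  using Imp_prenex eqv_Imp eqv_Sigma_eqv eqv_Pi_eqv unfolding eqv_Sigma_def[of n \<phi>] eqv_Sigma_def[of n \<psi>] eqv_Pi_def[of n \<phi>] eqv_Pi_def[of n \<psi>]
  by metis+

lemma Delta0_classes: "is_Delta0 \<phi> \<Longrightarrow> eqv_Sigma n \<phi> \<and> eqv_Pi n \<phi>"
proof (induction n)
  case 0
  then show ?case unfolding eqv_Sigma_def eqv_Pi_def by (auto intro: eqv_refl)
qed (blast intro: eqv_Sigma_Suc eqv_Pi_Suc)

lemma eqv_Sigma_Delta0: "is_Delta0 \<phi> \<Longrightarrow> eqv_Sigma n \<phi>"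
  and eqv_Pi_Delta0: "is_Delta0 \<phi> \<Longrightarrow> eqv_Pi n \<phi>"
  by (simp_all add: Delta0_classes)

lemma is_Delta0_derived:
  "is_Delta0 \<phi> \<Longrightarrow> is_Delta0 (Neg \<phi>)"
  "is_Delta0 \<phi> \<Longrightarrow> is_Delta0 \<psi> \<Longrightarrow> is_Delta0 (And \<phi> \<psi>)"
  "is_Delta0 \<phi> \<Longrightarrow> is_Delta0 \<psi> \<Longrightarrow> is_Delta0 (Or \<phi> \<psi>)"
  "is_Delta0 (Leq s t)"
  by (auto simp: Neg_def And_def Or_def Leq_def intro!: is_Delta0.intros)

lemmas is_Delta0_rules = is_Delta0.intros is_Delta0_derived

lemma eqv_Sigma_And: "eqv_Sigma n \<phi> \<Longrightarrow> eqv_Sigma n \<psi> \<Longrightarrow> eqv_Sigma n (And \<phi> \<psi>)"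
  and eqv_Pi_And: "eqv_Pi n \<phi> \<Longrightarrow> eqv_Pi n \<psi> \<Longrightarrow> eqv_Pi n (And \<phi> \<psi>)"
  unfolding And_def Neg_def
  by (simp_all add: eqv_Sigma_Imp eqv_Pi_Imp eqv_Sigma_Delta0 eqv_Pi_Delta0 is_Delta0.intros)

section \<open>Quantifier complexity of the axioms\<close>

lemma is_Delta0_lth: "is_Delta0 (lth_fm s l)"
  by (auto simp: lth_fm_def pair_fm_def intro!: is_Delta0_rules)

lemma is_Delta0_entry: "is_Delta0 (entry_fm s i r)"
  by (auto simp: entry_fm_def pair_fm_def Let_def intro!: is_Delta0_rules)

lemma eqv_Sigma_inst: "is_Sigma n \<phi> \<Longrightarrow> eqv_Sigma n (inst ts k \<phi>)"
  unfolding eqv_Sigma_def inst_def by (blast intro: is_Sigma_Pi_subst eqv_refl)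

lemma eqv_Sigma_self: "is_Sigma n \<phi> \<Longrightarrow> eqv_Sigma n \<phi>"
  unfolding eqv_Sigma_def by (blast intro: eqv_refl)

text \<open>An implication between Sigma_1 formulas is Pi_2, and so is its generalisation, the
  induction step; the premise of \<open>Ind\<close> is thus Sigma_3, which makes the whole
  Pi_3.\<close>

lemma eqv_Pi_Ind: "is_Sigma 1 \<phi> \<Longrightarrow> eqv_Pi 3 (Ind \<phi>)"
proof -
  assume \<phi>: "is_Sigma 1 \<phi>"
  have "eqv_Pi 2 (All (Imp \<phi> (inst [Add (Var 0) One] 1 \<phi>)))"
    using eqv_Sigma_Suc[OF eqv_Sigma_self[OF \<phi>]] eqv_Sigma_imp_eqv_Pi[OF eqv_Sigma_inst[OF \<phi>]]
    by (auto simp: numeral_2_eq_2 intro!: eqv_Pi_All eqv_Pi_Imp)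
  then have "eqv_Sigma 3 (And (inst [Zero] 0 \<phi>) (All (Imp \<phi> (inst [Add (Var 0) One] 1 \<phi>))))"
    using eqv_Sigma_inst[OF \<phi>]
    by (auto simp: numeral_2_eq_2 numeral_3_eq_3 intro!: eqv_Sigma_And intro: eqv_Sigma_Suc eqv_Pi_imp_eqv_Sigma)
  moreover have "eqv_Pi 3 (All \<phi>)"
    using eqv_Sigma_self[OF \<phi>]
    by (auto simp: numeral_3_eq_3 intro!: eqv_Pi_All intro: eqv_Pi_Suc eqv_Sigma_imp_eqv_Pi)
  ultimately show ?thesis
    unfolding Ind_def by (rule eqv_Pi_Imp)
qed

lemma eqv_Pi_PFUN: "is_Sigma 1 \<phi> \<Longrightarrow> eqv_Pi 1 (PFUN \<phi>)"
  unfolding PFUN_def One_nat_def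
  by (intro eqv_Pi_All eqv_Pi_Imp eqv_Sigma_And eqv_Sigma_inst eqv_Pi_Delta0 is_Delta0_rules)

text \<open>\<open>\<phi>\<close> occurs in \<open>Approx\<close> only as a premise, so
  \<open>Approx\<close> is Pi_1, and the prefix All Ex in front of it gives Pi_3.
  \<open>PFUN\<close> is Pi_1, so as a premise it does not raise the level.\<close>

lemma eqv_Pi_P_axiom: "is_Sigma 1 \<phi> \<Longrightarrow> eqv_Pi 3 (P_axiom \<phi>)"
proof -
  assume \<phi>: "is_Sigma 1 \<phi>"
  have inst: "eqv_Sigma (Suc 0) (inst ts k \<phi>)" for ts k
    using eqv_Sigma_inst[OF \<phi>] by simp
  have 1: "eqv_Sigma 3 (PFUN \<phi>)"
    using eqv_Pi_PFUN[OF \<phi>] by (auto simp: numeral_3_eq_3 intro: eqv_Pi_Suc eqv_Pi_imp_eqv_Sigma)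
  have "eqv_Pi (Suc 0) (Approx 2 \<phi> (Var 0))"
    unfolding Approx_def
    by (intro eqv_Pi_All_pow eqv_Pi_Imp eqv_Sigma_And inst) (intro eqv_Sigma_Delta0 eqv_Pi_Delta0 is_Delta0_rules is_Delta0_lth is_Delta0_entry)+
  then have "eqv_Sigma (Suc 1) (Ex (And (Approx 2 \<phi> (Var 0)) (lth_fm (Var 0) (Var 1))))"
    unfolding One_nat_def by (intro eqv_Sigma_Ex eqv_Pi_imp_eqv_Sigma eqv_Pi_And eqv_Pi_Delta0[OF is_Delta0_lth])
  then have "eqv_Pi 3 (All (Ex (And (Approx 2 \<phi> (Var 0)) (lth_fm (Var 0) (Var 1)))))"
    unfolding numeral_3_eq_3 One_nat_def by (intro eqv_Pi_All eqv_Sigma_imp_eqv_Pi)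
  with 1 show ?thesis
    unfolding P_axiom_def by (rule eqv_Pi_Imp)
qed

text \<open>Only the subtraction axiom contains an unbounded existential quantifier. Level 2 is what
  later carries these axioms over to the ultrapower.\<close>

lemma eqv_Pi_Pminus: "\<alpha> \<in> Pminus \<Longrightarrow> eqv_Pi 2 \<alpha>"
proof -
  have *: "eqv_Pi (Suc 1) (Imp (Less (Var 0) (Var 1)) (Ex (Eq (Add (Var 1) (Var 0)) (Var 2))))"
    unfolding One_nat_def
    by (rule eqv_Pi_Imp[OF eqv_Sigma_Delta0 eqv_Sigma_imp_eqv_Pi[OF eqv_Sigma_Ex[OF eqv_Sigma_Delta0]]]) (rule is_Delta0_rules)+
  assume "\<alpha> \<in> Pminus"
  then have "eqv_Pi (Suc 1) \<alpha>"
    unfolding Pminus_def univ_closure_def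
    by (elim imageE insertE emptyE; hypsubst; intro eqv_Pi_All_pow)
      (simp_all only: * eqv_Pi_Delta0 is_Delta0_rules)
  then show ?thesis by (simp add: numeral_2_eq_2)
qed

lemma eqv_Pi_PSigma1: "\<alpha> \<in> PSigma1 \<Longrightarrow> eqv_Pi 3 \<alpha>"
  using eqv_Pi_Suc[OF eqv_Pi_Pminus] eqv_Pi_Ind eqv_Pi_P_axiom
  by (auto simp: PSigma1_def ISigma1_def univ_closure_def numeral_3_eq_3 numeral_2_eq_2 intro: eqv_Pi_All_pow)

section \<open>Universal closures: from open prenex forms to sentences\<close>

lemma fvb_All_pow: "fvb ((All ^^ k) \<phi>) = fvb \<phi> - k"
  by (induction k) auto

lemma sentence_univ_closure: "sentence (univ_closure \<phi>)"
  by (simp add: sentence_def univ_closure_def fvb_All_pow)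

lemma sentence_PSigma1: "\<alpha> \<in> PSigma1 \<Longrightarrow> sentence \<alpha>"
  by (auto simp: PSigma1_def ISigma1_def Pminus_def sentence_univ_closure)

lemma All_pow_E: "\<Gamma> \<turnstile> (All ^^ length ts) \<phi> \<Longrightarrow> \<Gamma> \<turnstile> inst ts 0 \<phi>"
proof (induction ts arbitrary: \<phi>)
  case Nil
  then show ?case by (simp add: inst_def subst_Var)
next
  case (Cons t ts)
  have "\<Gamma> \<turnstile> inst ts 0 (All \<phi>)"
    using Cons by (simp add: funpow_swap1)
  then have "\<Gamma> \<turnstile> inst [t] 0 (subst (case_nat (Var 0) (\<lambda>n. shift 1 (if n < length ts then ts ! n else Var (n - length ts)))) \<phi>)"
    unfolding inst_def[of ts] subst.simps add_0_right by (rule AllE)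
  moreover have "inst [t] 0 (subst (case_nat (Var 0) (\<lambda>n. shift 1 (if n < length ts then ts ! n else Var (n - length ts)))) \<phi>)
      = inst (t # ts) 0 \<phi>"
    unfolding inst_single inst_def[of "t # ts"] subst_subst
    by (rule subst_cong) (auto simp: shift_def substt_substt substt_Var split: nat.split)
  ultimately show ?case by simp
qed

lemma univ_closure_E: "\<Gamma> \<turnstile> univ_closure \<phi> \<Longrightarrow> \<Gamma> \<turnstile> \<phi>"
proof -
  assume "\<Gamma> \<turnstile> univ_closure \<phi>"
  then have "\<Gamma> \<turnstile> inst (map Var [0..<fvb \<phi>]) 0 \<phi>"
    by (intro All_pow_E) (simp add: univ_closure_def)
  moreover have "inst (map Var [0..<fvb \<phi>]) 0 \<phi> = subst Var \<phi>"
    unfolding inst_def by (rule subst_cong) simp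
  ultimately show ?thesis by (simp add: subst_Var)
qed

lemma sentence_All_pow_I: "sentence \<alpha> \<Longrightarrow> {\<alpha>} \<turnstile> \<phi> \<Longrightarrow> {\<alpha>} \<turnstile> (All ^^ k) \<phi>"
  by (induction k) (auto intro!: lift_AllI simp: lift_sentence)

text \<open>The prenex form is not known to be a sentence. Closing it universally keeps it Pi, and a
  sentence that proves a formula also proves its closure.\<close>

lemma eqv_Pi_sentence:
  assumes "eqv_Pi (Suc n) \<alpha>" "sentence \<alpha>"
  shows "\<exists>\<beta>. sentence \<beta> \<and> is_Pi (Suc n) \<beta> \<and> eqv \<alpha> \<beta>"
proof -
  obtain \<psi> where \<psi>: "is_Pi (Suc n) \<psi>" "eqv \<alpha> \<psi>"
    using assms(1) by (auto simp: eqv_Pi_def)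
  have "is_Pi (Suc n) ((All ^^ k) \<psi>)" for k
    by (induction k) (auto intro: \<psi>(1) is_Pi_All)
  moreover have "eqv \<alpha> (univ_closure \<psi>)"
    unfolding eqv_def
  proof
    show "{\<alpha>} \<turnstile> univ_closure \<psi>"
      using \<psi>(2) assms(2) sentence_All_pow_I by (simp add: eqv_def univ_closure_def)
    show "{univ_closure \<psi>} \<turnstile> \<alpha>"
      by (rule eqv_D[OF eqv_sym[OF \<psi>(2)] univ_closure_E[OF Assm]]) simp
  qed
  ultimately show ?thesis
    using sentence_univ_closure by (auto simp: univ_closure_def)
qed

lemma PSigma1_Pi3:
  "\<exists>T. (\<forall>\<phi>\<in>T. sentence \<phi> \<and> is_Pi 3 \<phi>) \<and> same_theorems T PSigma1"
proof (intro exI conjI)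
  let ?T = "{\<beta>. sentence \<beta> \<and> is_Pi 3 \<beta> \<and> (\<exists>\<alpha>\<in>PSigma1. eqv \<alpha> \<beta>)}"
  show "\<forall>\<phi>\<in>?T. sentence \<phi> \<and> is_Pi 3 \<phi>" by blast
  have 1: "PSigma1 \<turnstile> \<beta>" if "\<beta> \<in> ?T" for \<beta>
    using that eqv_D[OF _ Assm] by auto
  have 2: "?T \<turnstile> \<alpha>" if \<alpha>: "\<alpha> \<in> PSigma1" for \<alpha>
  proof -
    obtain \<beta> where \<beta>: "sentence \<beta>" "is_Pi 3 \<beta>" "eqv \<alpha> \<beta>"
      using eqv_Pi_sentence[of 2 \<alpha>] eqv_Pi_PSigma1[OF \<alpha>] sentence_PSigma1[OF \<alpha>]
      by (auto simp: numeral_3_eq_3 numeral_2_eq_2)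
    with \<alpha> have "?T \<turnstile> \<beta>" by (blast intro: Assm)
    with \<beta> show ?thesis using eqv_D[OF eqv_sym] by blast
  qed
  show "same_theorems ?T PSigma1"
    unfolding same_theorems_def
  proof (intro allI impI iffI)
    show "PSigma1 \<turnstile> \<phi>" if "?T \<turnstile> \<phi>" for \<phi>
      by (rule cut_set[OF that 1])
    show "?T \<turnstile> \<phi>" if "PSigma1 \<turnstile> \<phi>" for \<phi>
      by (rule cut_set[OF that 2])
  qed
qed

subsection \<open>Structures and soundness\<close>

text \<open>Equality is interpreted by a congruence, so that the ultrapower can have functions
  themselves as elements, without passing to a quotient.\<close>

locale fo_structure =
  fixes dom :: "'a set" and eq less :: "'a \<Rightarrow> 'a \<Rightarrow> bool"
    and zero one :: 'a and add mul :: "'a \<Rightarrow> 'a \<Rightarrow> 'a"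
  assumes zero_dom: "zero \<in> dom" and one_dom: "one \<in> dom"
    and add_dom: "x \<in> dom \<Longrightarrow> y \<in> dom \<Longrightarrow> add x y \<in> dom"
    and mul_dom: "x \<in> dom \<Longrightarrow> y \<in> dom \<Longrightarrow> mul x y \<in> dom"
    and eq_refl: "eq x x"
    and eq_sym: "eq x y \<Longrightarrow> eq y x"
    and eq_trans: "eq x y \<Longrightarrow> eq y z \<Longrightarrow> eq x z"
    and add_cong: "eq x x' \<Longrightarrow> eq y y' \<Longrightarrow> eq (add x y) (add x' y')"
    and mul_cong: "eq x x' \<Longrightarrow> eq y y' \<Longrightarrow> eq (mul x y) (mul x' y')"
    and less_cong: "eq x x' \<Longrightarrow> eq y y' \<Longrightarrow> less x y \<Longrightarrow> less x' y'"
begin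

primrec tval :: "(nat \<Rightarrow> 'a) \<Rightarrow> tm \<Rightarrow> 'a" where
  "tval \<rho> (Var n) = \<rho> n"
| "tval \<rho> Zero = zero"
| "tval \<rho> One = one"
| "tval \<rho> (Add s t) = add (tval \<rho> s) (tval \<rho> t)"
| "tval \<rho> (Mul s t) = mul (tval \<rho> s) (tval \<rho> t)"

primrec sat :: "(nat \<Rightarrow> 'a) \<Rightarrow> fm \<Rightarrow> bool" where
  "sat \<rho> (Eq s t) \<longleftrightarrow> eq (tval \<rho> s) (tval \<rho> t)"
| "sat \<rho> (Less s t) \<longleftrightarrow> less (tval \<rho> s) (tval \<rho> t)"
| "sat \<rho> Bot \<longleftrightarrow> False"
| "sat \<rho> (Imp \<phi> \<psi>) \<longleftrightarrow> (sat \<rho> \<phi> \<longrightarrow> sat \<rho> \<psi>)"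
| "sat \<rho> (All \<phi>) \<longleftrightarrow> (\<forall>x\<in>dom. sat (case_nat x \<rho>) \<phi>)"

lemma sat_derived [simp]:
  "sat \<rho> (Neg \<phi>) \<longleftrightarrow> \<not> sat \<rho> \<phi>"
  "sat \<rho> (Or \<phi> \<psi>) \<longleftrightarrow> sat \<rho> \<phi> \<or> sat \<rho> \<psi>"
  "sat \<rho> (And \<phi> \<psi>) \<longleftrightarrow> sat \<rho> \<phi> \<and> sat \<rho> \<psi>"
  "sat \<rho> (Iff \<phi> \<psi>) \<longleftrightarrow> (sat \<rho> \<phi> \<longleftrightarrow> sat \<rho> \<psi>)"
  "sat \<rho> (Ex \<phi>) \<longleftrightarrow> (\<exists>x\<in>dom. sat (case_nat x \<rho>) \<phi>)"
  "sat \<rho> (Leq s t) \<longleftrightarrow> less (tval \<rho> s) (tval \<rho> t) \<or> eq (tval \<rho> s) (tval \<rho> t)"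
  by (auto simp: Neg_def Or_def And_def Iff_def Ex_def Leq_def)

lemma tval_substt: "tval \<rho> (substt \<sigma> t) = tval (\<lambda>n. tval \<rho> (\<sigma> n)) t"
  by (induction t) auto

lemma tval_shift [simp]: "tval \<rho> (shift k t) = tval (\<lambda>n. \<rho> (n + k)) t"
  by (simp add: shift_def tval_substt)

lemma sat_quantifiers [simp]:
  "sat \<rho> (BAll t \<phi>) \<longleftrightarrow> (\<forall>x\<in>dom. less x (tval \<rho> t) \<longrightarrow> sat (case_nat x \<rho>) \<phi>)"
  "sat \<rho> (BEx t \<phi>) \<longleftrightarrow> (\<exists>x\<in>dom. less x (tval \<rho> t) \<and> sat (case_nat x \<rho>) \<phi>)"
  by (simp_all add: BAll_def BEx_def)

lemma sat_subst: "sat \<rho> (subst \<sigma> \<phi>) \<longleftrightarrow> sat (\<lambda>n. tval \<rho> (\<sigma> n)) \<phi>"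
proof (induction \<phi> arbitrary: \<rho> \<sigma>)
  case (All \<phi>)
  have "(\<lambda>n. tval (case_nat x \<rho>) (case_nat (Var 0) (\<lambda>n. shift 1 (\<sigma> n)) n)) = case_nat x (\<lambda>n. tval \<rho> (\<sigma> n))" for x
    by (rule ext) (simp split: nat.split)
  then show ?case
    unfolding subst.simps sat.simps All.IH by presburger
qed (auto simp: tval_substt)

lemma sat_inst:
  "sat \<rho> (inst [t] k \<phi>) \<longleftrightarrow> sat (case_nat (tval \<rho> t) (\<lambda>n. \<rho> (n + k))) \<phi>"
  "sat \<rho> (inst [s, t] k \<phi>) \<longleftrightarrow> sat (case_nat (tval \<rho> s) (case_nat (tval \<rho> t) (\<lambda>n. \<rho> (n + k)))) \<phi>"
  unfolding inst_def sat_subst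
  by (rule arg_cong2[where f = sat]; auto simp: fun_eq_iff split: nat.split)+

lemma sat_lift: "sat \<rho> (lift \<phi>) \<longleftrightarrow> sat (\<lambda>n. \<rho> (Suc n)) \<phi>"
  by (simp add: lift_def sat_subst)

lemma tval_cong: "(\<And>n. n < fvbt t \<Longrightarrow> \<rho> n = \<rho>' n) \<Longrightarrow> tval \<rho> t = tval \<rho>' t"
  by (induction t) auto

lemma sat_cong: "(\<And>n. n < fvb \<phi> \<Longrightarrow> \<rho> n = \<rho>' n) \<Longrightarrow> sat \<rho> \<phi> \<longleftrightarrow> sat \<rho>' \<phi>"
proof (induction \<phi> arbitrary: \<rho> \<rho>')
  case (Eq s t)
  have "tval \<rho> s = tval \<rho>' s" "tval \<rho> t = tval \<rho>' t"
    by (rule tval_cong, rule Eq, simp)+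
  then show ?case by simp
next
  case (Less s t)
  have "tval \<rho> s = tval \<rho>' s" "tval \<rho> t = tval \<rho>' t"
    by (rule tval_cong, rule Less, simp)+
  then show ?case by simp
next
  case (Imp \<phi> \<psi>)
  have "sat \<rho> \<phi> = sat \<rho>' \<phi>" "sat \<rho> \<psi> = sat \<rho>' \<psi>"
    by (rule Imp.IH, rule Imp.prems, simp)+
  then show ?case by simp
next
  case (All \<phi>)
  have "sat (case_nat x \<rho>) \<phi> \<longleftrightarrow> sat (case_nat x \<rho>') \<phi>" for x
  proof (rule All.IH)
    show "case_nat x \<rho> n = case_nat x \<rho>' n" if "n < fvb \<phi>" for n
      using that All.prems[of "n - 1"] by (cases n) auto
  qed
  then show ?case by simp
qed simp

lemma tval_eq: "(\<And>n. eq (\<rho> n) (\<rho>' n)) \<Longrightarrow> eq (tval \<rho> t) (tval \<rho>' t)"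
  by (induction t) (auto intro: eq_refl add_cong mul_cong)

lemma sat_eq: "(\<And>n. eq (\<rho> n) (\<rho>' n)) \<Longrightarrow> sat \<rho> \<phi> \<longleftrightarrow> sat \<rho>' \<phi>"
proof (induction \<phi> arbitrary: \<rho> \<rho>')
  case (Eq s t)
  from tval_eq[OF Eq] show ?case
    unfolding sat.simps by (meson eq_sym eq_trans)
next
  case (Less s t)
  from tval_eq[OF Less] show ?case
    unfolding sat.simps by (meson eq_sym less_cong)
next
  case (Imp \<phi> \<psi>)
  then show ?case by (metis sat.simps(4))
next
  case (All \<phi>)
  have "sat (case_nat x \<rho>) \<phi> \<longleftrightarrow> sat (case_nat x \<rho>') \<phi>" for x
    by (rule All.IH) (simp add: All.prems eq_refl split: nat.split)
  then show ?case by simp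
qed simp

definition env :: "(nat \<Rightarrow> 'a) \<Rightarrow> bool" where
  "env \<rho> \<longleftrightarrow> (\<forall>n. \<rho> n \<in> dom)"

lemma env_case_nat [simp]: "env (case_nat x \<rho>) \<longleftrightarrow> x \<in> dom \<and> env \<rho>"
  unfolding env_def by (metis nat.simps(4,5) not0_implies_Suc)

lemma tval_dom: "env \<rho> \<Longrightarrow> tval \<rho> t \<in> dom"
  by (induction t) (auto simp: env_def zero_dom one_dom add_dom mul_dom)

lemma soundness: "\<Gamma> \<turnstile> \<phi> \<Longrightarrow> env \<rho> \<Longrightarrow> (\<And>\<psi>. \<psi> \<in> \<Gamma> \<Longrightarrow> sat \<rho> \<psi>) \<Longrightarrow> sat \<rho> \<phi>"
proof (induction arbitrary: \<rho> rule: proves.induct)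
  case (Contr \<phi> \<Gamma>)
  then show ?case by (metis insert_iff sat.simps(3) sat_derived(1))
next
  case (AllI \<Gamma> \<phi>)
  have "sat (case_nat x \<rho>) \<phi>" if "x \<in> dom" for x
  proof (rule AllI.IH)
    show "env (case_nat x \<rho>)"
      using that AllI.prems(1) by simp
    show "sat (case_nat x \<rho>) \<psi>" if "\<psi> \<in> inst [] 1 ` \<Gamma>" for \<psi>
      using that AllI.prems(2) by (auto simp only: inst_Nil_1 sat_lift nat.case)
  qed
  then show ?case by simp
next
  case (AllE \<Gamma> \<phi> t)
  then have "sat (case_nat (tval \<rho> t) \<rho>) \<phi>"
    using tval_dom by auto
  then show ?case by (simp add: sat_inst)
next
  case (EqRefl \<Gamma> t)
  then show ?case by (simp add: eq_refl)
next
  case (EqSubst \<Gamma> s t \<phi>)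
  then have "eq (tval \<rho> s) (tval \<rho> t)" "sat (case_nat (tval \<rho> s) \<rho>) \<phi>"
    by (auto simp: sat_inst)
  then have "sat (case_nat (tval \<rho> t) \<rho>) \<phi>"
    by (subst sat_eq[of _ "case_nat (tval \<rho> s) \<rho>"]) (auto simp: eq_refl eq_sym split: nat.split)
  then show ?case by (simp add: sat_inst)
qed auto

text \<open>\<open>v\<close> is indexed by de Bruijn indices, so \<open>v 0\<close> is the value of
  the innermost variable; accordingly the induction splits off the innermost quantifier.\<close>

lemma sat_All_pow:
  "sat \<rho> ((All ^^ k) \<phi>) \<longleftrightarrow> (\<forall>v. (\<forall>j<k. v j \<in> dom) \<longrightarrow> sat (\<lambda>n. if n < k then v n else \<rho> (n - k)) \<phi>)"
proof (induction k arbitrary: \<phi>)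
  case (Suc k)
  have 1: "case_nat (v 0) (\<lambda>n. if n < k then v (Suc n) else \<rho> (n - k))
      = (\<lambda>n. if n < Suc k then v n else \<rho> (n - Suc k))" for v
    by (auto simp: fun_eq_iff split: nat.split)
  have "sat \<rho> ((All ^^ Suc k) \<phi>) \<longleftrightarrow>
      (\<forall>v. (\<forall>j<k. v j \<in> dom) \<longrightarrow> (\<forall>x\<in>dom. sat (case_nat x (\<lambda>n. if n < k then v n else \<rho> (n - k))) \<phi>))"
    using Suc.IH[of "All \<phi>"] by (simp add: funpow_swap1)
  also have "\<dots> \<longleftrightarrow> (\<forall>v. (\<forall>j<Suc k. v j \<in> dom) \<longrightarrow>
      sat (case_nat (v 0) (\<lambda>n. if n < k then v (Suc n) else \<rho> (n - k))) \<phi>)"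
  proof (intro iffI allI impI ballI)
    fix v x assume *: "\<forall>v. (\<forall>j<Suc k. v j \<in> dom) \<longrightarrow>
      sat (case_nat (v 0) (\<lambda>n. if n < k then v (Suc n) else \<rho> (n - k))) \<phi>"
      "\<forall>j<k. v j \<in> dom" "x \<in> dom"
    then have "\<forall>j<Suc k. case_nat x v j \<in> dom"
      by (auto split: nat.split)
    with *(1)[rule_format, of "case_nat x v"]
    show "sat (case_nat x (\<lambda>n. if n < k then v n else \<rho> (n - k))) \<phi>"
      by (simp cong: if_cong)
  next
    fix v assume *: "\<forall>v. (\<forall>j<k. v j \<in> dom) \<longrightarrow> (\<forall>x\<in>dom. sat (case_nat x (\<lambda>n. if n < k then v n else \<rho> (n - k))) \<phi>)"
      "\<forall>j<Suc k. v j \<in> dom"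
    show "sat (case_nat (v 0) (\<lambda>n. if n < k then v (Suc n) else \<rho> (n - k))) \<phi>"
      using *(1)[rule_format, of "\<lambda>n. v (Suc n)"] *(2) by simp
  qed
  finally show ?case unfolding 1 .
qed simp

lemma sat_Ex_pow:
  "sat \<rho> ((Ex ^^ k) \<phi>) \<longleftrightarrow> (\<exists>v. (\<forall>j<k. v j \<in> dom) \<and> sat (\<lambda>n. if n < k then v n else \<rho> (n - k)) \<phi>)"
proof -
  have "sat \<rho> ((Ex ^^ k) \<phi>) \<longleftrightarrow> \<not> sat \<rho> ((All ^^ k) (Neg \<phi>))" for \<rho>
    by (induction k arbitrary: \<rho>) auto
  then show ?thesis by (simp add: sat_All_pow)
qed

lemma sat_univ_closureI: "env \<rho> \<Longrightarrow> (\<And>\<rho>. env \<rho> \<Longrightarrow> sat \<rho> \<phi>) \<Longrightarrow> sat \<rho> (univ_closure \<phi>)"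
  by (auto simp: univ_closure_def sat_All_pow env_def)

lemma sat_univ_closureD: "sat \<rho> (univ_closure \<phi>) \<Longrightarrow> env \<rho>' \<Longrightarrow> sat \<rho>' \<phi>"
proof -
  assume "sat \<rho> (univ_closure \<phi>)" "env \<rho>'"
  then have "sat (\<lambda>n. if n < fvb \<phi> then \<rho>' n else \<rho> (n - fvb \<phi>)) \<phi>"
    by (simp add: univ_closure_def sat_All_pow env_def)
  then show ?thesis
    by (rule sat_cong[THEN iffD1, rotated]) simp
qed

lemma case_nat_add_numeral [simp]: "case_nat x f (n + numeral k) = f (n + pred_numeral k)"
  by (simp add: numeral_eq_Suc)

lemma sat_PFUN:
  "sat \<rho> (PFUN \<phi>) \<longleftrightarrow> (\<forall>x\<in>dom. \<forall>y\<in>dom. \<forall>y'\<in>dom.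
     sat (case_nat x (case_nat y \<rho>)) \<phi> \<longrightarrow> sat (case_nat x (case_nat y' \<rho>)) \<phi> \<longrightarrow> eq y y')"
  by (auto simp: PFUN_def sat_inst)

text \<open>The subformulas for length and entries stay unevaluated, because they are treated
  differently later: by direct evaluation in the standard model, through \<open>Los\<close> in the
  ultrapower.\<close>

lemma sat_Approx:
  "sat \<rho> (Approx k \<phi> s) \<longleftrightarrow>
    (\<forall>i\<in>dom. \<forall>x\<in>dom. \<forall>y\<in>dom. \<forall>l\<in>dom. \<forall>u\<in>dom. \<forall>v\<in>dom.
      let \<rho>' = case_nat v (case_nat u (case_nat l (case_nat y (case_nat x (case_nat i \<rho>))))) in
      sat \<rho>' (lth_fm (shift 6 s) (Var 2)) \<longrightarrow> less (add i one) l \<longrightarrow>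
      sat \<rho>' (entry_fm (shift 6 s) (Var 5) (Var 1)) \<longrightarrow>
      sat \<rho>' (entry_fm (shift 6 s) (Succ (Var 5)) (Var 0)) \<longrightarrow>
      less x u \<or> eq x u \<longrightarrow> sat (case_nat x (case_nat y (\<lambda>n. \<rho> (n + k)))) \<phi> \<longrightarrow>
      less y v \<or> eq y v)"
proof -
  have 6: "(All ^^ 6) \<psi> = All (All (All (All (All (All \<psi>)))))" for \<psi>
    by (simp add: numeral_eq_Suc)
  have "(\<lambda>n. case_nat v (case_nat u (case_nat l (case_nat y (case_nat x (case_nat i \<rho>))))) (n + (k + 6)))
      = (\<lambda>n. \<rho> (n + k))" for v u l y x i
    by (simp add: numeral_eq_Suc)
  then show ?thesis
    unfolding Approx_def 6 by (simp add: sat_inst Succ_def Let_def imp_conjL)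
qed

end

subsection \<open>The standard model\<close>

interpretation std: fo_structure UNIV "(=)" "(<)" "0 :: nat" "Suc 0" "(+)" "(*)"
  by unfold_locales auto

lemma std_env [simp]: "std.env \<rho>"
  by (simp add: std.env_def)

text \<open>The Cantor pairing of the coding adds the second component to the triangle number,
  \<open>prod_encode\<close> the first; hence the swap here and in the later translations.\<close>

lemma prod_encode_iff: "(x + y) * (x + y + 1) + (y + y) = z + z \<longleftrightarrow> z = prod_encode (y, x)"
proof -
  have "2 * triangle n = n * (n + 1)" for n
    by (induction n) auto
  from this[of "y + x"] show ?thesis
    unfolding prod_encode_def by (simp add: add.commute) linarith
qed

lemma std_pair_fm [simp]:
  "std.sat \<rho> (pair_fm x y z) \<longleftrightarrow> std.tval \<rho> z = prod_encode (std.tval \<rho> y, std.tval \<rho> x)"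
  using prod_encode_iff[of "std.tval \<rho> x" "std.tval \<rho> y" "std.tval \<rho> z"]
  by (simp add: pair_fm_def Succ_def)

lemma std_lth_fm [simp]:
  "std.sat \<rho> (lth_fm s l) \<longleftrightarrow> (\<exists>p. std.tval \<rho> s = prod_encode (std.tval \<rho> l, p))"
  by (auto simp: lth_fm_def Succ_def less_Suc_eq_le le_prod_encode_2)

lemma std_entry_fm [simp]:
  "std.sat \<rho> (entry_fm s i r) \<longleftrightarrow>
    (\<exists>l a b. std.tval \<rho> s = prod_encode (l, prod_encode (b, a)) \<and>
       std.tval \<rho> r = a mod (1 + (std.tval \<rho> i + 1) * b))"
proof -
  have "std.sat \<rho> (entry_fm s i r) \<longleftrightarrow>
    (\<exists>p<Suc (std.tval \<rho> s). \<exists>l<Suc (std.tval \<rho> s). \<exists>a<Suc p. \<exists>b<Suc p. \<exists>q<Suc a.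
      std.tval \<rho> s = prod_encode (l, p) \<and> p = prod_encode (b, a) \<and>
      a = q * Suc (Suc (std.tval \<rho> i) * b) + std.tval \<rho> r \<and> std.tval \<rho> r < Suc (Suc (std.tval \<rho> i) * b))"
    by (simp add: entry_fm_def Succ_def Let_def del: prod_encode_eq)
  also have "\<dots> \<longleftrightarrow> (\<exists>l a b. std.tval \<rho> s = prod_encode (l, prod_encode (b, a)) \<and>
       std.tval \<rho> r = a mod (1 + (std.tval \<rho> i + 1) * b))" (is "?L = ?R")
  proof
    assume ?L
    then obtain p l a b q where *: "std.tval \<rho> s = prod_encode (l, p)" "p = prod_encode (b, a)"
      "a = q * Suc (Suc (std.tval \<rho> i) * b) + std.tval \<rho> r"
      "std.tval \<rho> r < Suc (Suc (std.tval \<rho> i) * b)"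
      by blast
    have "std.tval \<rho> r = a mod Suc (Suc (std.tval \<rho> i) * b)"
      by (subst *(3)) (simp only: mod_mult_self3 mod_less *(4))
    with *(1,2) show ?R by auto
  next
    assume ?R
    then obtain l a b where *: "std.tval \<rho> s = prod_encode (l, prod_encode (b, a))"
       "std.tval \<rho> r = a mod Suc (Suc (std.tval \<rho> i) * b)" by auto
    have "a = a div Suc (Suc (std.tval \<rho> i) * b) * Suc (Suc (std.tval \<rho> i) * b) + std.tval \<rho> r"
      "a div Suc (Suc (std.tval \<rho> i) * b) < Suc a"
      by (simp_all only: *(2) div_mult_mod_eq less_Suc_eq_le div_le_dividend)
    moreover have "std.tval \<rho> r < Suc (Suc (std.tval \<rho> i) * b)"
      by (simp only: *(2) mod_less_divisor zero_less_Suc)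
    moreover have "a < Suc (prod_encode (b, a))" "b < Suc (prod_encode (b, a))"
      "l < Suc (std.tval \<rho> s)" "prod_encode (b, a) < Suc (std.tval \<rho> s)"
      by (simp_all add: *(1) less_Suc_eq_le le_prod_encode_1 le_prod_encode_2)
    ultimately show ?L
      using *(1) by blast
  qed
  finally show ?thesis .
qed

text \<open>Goedel's beta lemma. With \<open>b\<close> a factorial the moduli are pairwise coprime,
  and the Chinese remainder theorem yields \<open>a\<close>; \<open>b\<close> is also so large that
  each \<open>c i\<close> is a possible remainder.\<close>

lemma beta:
  fixes c :: "nat \<Rightarrow> nat"
  shows "\<exists>a b. \<forall>i<l. a mod (1 + (i + 1) * b) = c i"
proof -
  \<comment> \<open>\<open>M\<close> bounds both the differences of indices and all the values
    \<open>c i\<close>.\<close>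
  define M where "M = l + sum c {..<l}"
  define b :: nat where "b = fact M"
  have "coprime (1 + (i + 1) * b) (1 + (j + 1) * b)" if "i < j" "j < l" for i j
  proof (rule ccontr)
    assume "\<not> coprime (1 + (i + 1) * b) (1 + (j + 1) * b)"
    then obtain p where p: "prime p" "p dvd 1 + (i + 1) * b" "p dvd 1 + (j + 1) * b"
      using prime_factor_nat[of "gcd (1 + (i + 1) * b) (1 + (j + 1) * b)"]
      by (auto simp only: coprime_iff_gcd_eq_1 gcd_greatest_iff)
    have nb: "\<not> p dvd b"
    proof
      assume "p dvd b"
      then have "p dvd 1" using p(2) by (metis dvd_add_left_iff dvd_mult)
      with p(1) show False by simp
    qed
    \<comment> \<open>A common prime divisor divides the difference of the moduli but not
      \<open>b\<close>, hence it divides \<open>j - i\<close>. Being at most \<open>M\<close>, it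
      then divides the factorial \<open>b\<close> after all.\<close>
    have "(1 + (j + 1) * b) - (1 + (i + 1) * b) = (j - i) * b"
      by (simp add: diff_mult_distrib)
    then have "p dvd (j - i) * b"
      using p(2,3) by (metis dvd_diff_nat)
    with p(1) nb have "p dvd j - i"
      using prime_dvd_multD by blast
    with that have "p \<le> M"
      using dvd_imp_le[of p "j - i"] by (simp add: M_def)
    moreover have "1 \<le> p" using p(1) prime_ge_1_nat by blast
    ultimately have "p dvd b" unfolding b_def by (intro dvd_fact)
    with nb show False by simp
  qed
  then have "\<forall>i\<in>{..<l}. \<forall>j\<in>{..<l}. i \<noteq> j \<longrightarrow> coprime (1 + (i + 1) * b) (1 + (j + 1) * b)"
    by (metis coprime_commute lessThan_iff linorder_neqE_nat)
  then obtain a where a: "\<forall>i\<in>{..<l}. [a = c i] (mod (1 + (i + 1) * b))"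
    using chinese_remainder_nat[of "{..<l}" "\<lambda>i. 1 + (i + 1) * b" c] by blast
  have "a mod (1 + (i + 1) * b) = c i" if "i < l" for i
  proof -
    have "c i \<le> M"
      unfolding M_def using that by (intro trans_le_add2 member_le_sum) auto
    also have "M \<le> b" unfolding b_def by (rule fact_ge_self)
    finally have "c i < 1 + (i + 1) * b" by simp
    then show ?thesis using a that by (simp add: cong_def)
  qed
  then show ?thesis by blast
qed

text \<open>A functional relation on the natural numbers is bounded on each initial segment;
  iterating such a bound \<open>g\<close> from 0 gives an approximation of any length, coded by
  \<open>beta\<close>.\<close>

lemma std_P_axiom: "std.sat \<rho> (P_axiom \<phi>)"
proof -
  define R where "R x y \<longleftrightarrow> std.sat (case_nat x (case_nat y \<rho>)) \<phi>" for x y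
  have "std.sat (case_nat z \<rho>) (Ex (And (Approx 2 \<phi> (Var 0)) (lth_fm (Var 0) (Var 1))))"
    if fn: "\<And>x y y'. R x y \<Longrightarrow> R x y' \<Longrightarrow> y = y'" for z
  proof -
    have "\<exists>B. \<forall>x\<le>m. \<forall>y. R x y \<longrightarrow> y \<le> B" for m
    proof (induction m)
      case 0
      then show ?case using fn by (metis bot_nat_0.extremum_uniqueI order_refl)
    next
      case (Suc m)
      then obtain B where B: "\<forall>x\<le>m. \<forall>y. R x y \<longrightarrow> y \<le> B" by blast
      obtain B' where "\<forall>y. R (Suc m) y \<longrightarrow> y \<le> B'" using fn by (metis order_refl)
      with B show ?case
        by (intro exI[of _ "max B B'"]) (auto simp: le_Suc_eq le_max_iff_disj)
    qed
    then obtain g where g: "\<And>m x y. x \<le> m \<Longrightarrow> R x y \<Longrightarrow> y \<le> g m" by metis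
    define c where "c i = (g ^^ i) 0" for i
    obtain a b where ab: "\<forall>i<z. a mod (1 + (i + 1) * b) = c i"
      using beta by blast
    \<comment> \<open>\<open>c\<close> and \<open>c_Suc\<close> restate this with the moduli in the
      form that the simplifier produces.\<close>
    then have c: "a mod Suc (b + i * b) = c i" if "i < z" for i
      using that by simp
    have c_Suc: "a mod Suc (b + (b + i * b)) = g (c i)" if "Suc i < z" for i
      using c[OF that] by (simp add: c_def)
    let ?s = "prod_encode (z, prod_encode (b, a))"
    have "std.sat (case_nat ?s (case_nat z \<rho>)) (Approx 2 \<phi> (Var 0))"
      using g[unfolded R_def] by (auto simp: std.sat_Approx Let_def c c_Suc Succ_def simp flip: le_eq_less_or_eq)
    then show ?thesis
      unfolding std.sat_derived by (intro bexI[of _ ?s]) simp_all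
  qed
  then show ?thesis
    by (auto simp: P_axiom_def std.sat_PFUN R_def)
qed

lemma std_Ind: "std.sat \<rho> (Ind \<phi>)"
proof -
  have "std.sat (case_nat x \<rho>) \<phi>"
    if "std.sat (case_nat 0 \<rho>) \<phi>" "\<And>x. std.sat (case_nat x \<rho>) \<phi> \<Longrightarrow> std.sat (case_nat (x + 1) \<rho>) \<phi>" for x
    using that by (induction x) auto
  then show ?thesis by (auto simp: Ind_def std.sat_inst)
qed

lemma ex_add_eq: "(\<exists>x. x + a = b) \<longleftrightarrow> a \<le> b" for a b :: nat
  by (metis le_add2 le_add_diff_inverse2)

lemma std_Pminus: "\<alpha> \<in> Pminus \<Longrightarrow> std.sat \<rho> \<alpha>"
  unfolding Pminus_def
  by (elim imageE insertE emptyE; hypsubst; intro std.sat_univ_closureI)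
    (auto simp: algebra_simps ex_add_eq)

lemma std_PSigma1: "\<alpha> \<in> PSigma1 \<Longrightarrow> std.sat \<rho> \<alpha>"
  unfolding PSigma1_def ISigma1_def
  by (auto intro: std_Pminus std_Ind std_P_axiom intro!: std.sat_univ_closureI)

subsection \<open>Computable functions\<close>

abbreviation pr :: "nat \<Rightarrow> nat \<Rightarrow> nat" where
  "pr x y \<equiv> prod_encode (x, y)"

text \<open>
  A program is coded as \<open>pr (pr f g) k\<close> with opcode \<open>k\<close>: identity (0), projections (1, 2),
  composition \<open>g \<circ> f\<close> (3), pointwise sum, product, pairing and the test \<open>\<le>\<close> of the outputs
  of \<open>f\<close> and \<open>g\<close> (4 to 7), and on the input \<open>pr u v\<close> the search for the least zero \<open>z \<ge> v\<close> of
  \<open>\<lambda>z. f (pr u z)\<close> (8). The identity has code \<open>0\<close>, on which the final argument relies.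
\<close>

definition clause :: "(nat \<Rightarrow> nat \<Rightarrow> nat \<Rightarrow> bool) \<Rightarrow> nat \<Rightarrow> nat \<Rightarrow> nat \<Rightarrow>
    nat \<Rightarrow> nat \<Rightarrow> nat \<Rightarrow> nat \<Rightarrow> nat \<Rightarrow> nat \<Rightarrow> nat \<Rightarrow> nat \<Rightarrow> bool" where
  "clause A e x y f g p k u v w t \<longleftrightarrow> p = pr f g \<and> e = pr p k \<and>
    (k = 0 \<and> y = x \<or>
     k = 1 \<and> x = pr y u \<or>
     k = 2 \<and> x = pr u y \<or>
     k = 3 \<and> A f x u \<and> A g u y \<or>
     A f x u \<and> A g x v \<and>
       (k = 4 \<and> y = u + v \<or> k = 5 \<and> y = u * v \<or> k = 6 \<and> y = pr u v \<or>
        k = 7 \<and> u \<le> v \<and> y = 1 \<or> k = 7 \<and> v < u \<and> y = 0) \<or>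
     k = 8 \<and> x = pr u v \<and> A f x 0 \<and> y = v \<or>
     k = 8 \<and> x = pr u v \<and> A f x w \<and> 0 < w \<and> t = pr u (v + 1) \<and> A e t y)"

text \<open>One bound for all auxiliary numbers lets this be written as a \<Delta>0 formula,
  \<open>justified_fm\<close>.\<close>

definition justified :: "nat \<Rightarrow> (nat \<Rightarrow> nat \<Rightarrow> nat \<Rightarrow> bool) \<Rightarrow> nat \<Rightarrow> nat \<Rightarrow> nat \<Rightarrow> bool" where
  "justified B A e x y \<longleftrightarrow>
    (\<exists>f<B. \<exists>g<B. \<exists>p<B. \<exists>k<B. \<exists>u<B. \<exists>v<B. \<exists>w<B. \<exists>t<B. clause A e x y f g p k u v w t)"

text \<open>
  \<open>stage B h\<close> consists of the computations of height at most \<open>h\<close> in which all numbers are below \<open>B\<close>.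
\<close>

primrec stage :: "nat \<Rightarrow> nat \<Rightarrow> nat \<Rightarrow> nat \<Rightarrow> nat \<Rightarrow> bool" where
  "stage B 0 e x y \<longleftrightarrow> False"
| "stage B (Suc h) e x y \<longleftrightarrow> e < B \<and> x < B \<and> y < B \<and> justified B (stage B h) e x y"

definition outputs :: "nat \<Rightarrow> nat \<Rightarrow> nat \<Rightarrow> bool" where
  "outputs e x y \<longleftrightarrow> (\<exists>B h. stage B h e x y)"

lemma clause_mono:
  assumes "clause A e x y f g p k u v w t"
    and "\<And>e x y. e < B \<Longrightarrow> x < B \<Longrightarrow> y < B \<Longrightarrow> A e x y \<Longrightarrow> A' e x y"
    and "e < B" "x < B" "y < B" "f < B" "g < B" "u < B" "v < B" "w < B" "t < B"
  shows "clause A' e x y f g p k u v w t"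
proof -
  \<comment> \<open>The search clause has the premise \<open>A f x 0\<close>, so 0 has to lie below
    the bound as well.\<close>
  have "0 < B" using \<open>e < B\<close> by simp
  then have "A f x u \<Longrightarrow> A' f x u" "A g u y \<Longrightarrow> A' g u y" "A g x v \<Longrightarrow> A' g x v" "A f x 0 \<Longrightarrow> A' f x 0"
    "A f x w \<Longrightarrow> A' f x w" "A e t y \<Longrightarrow> A' e t y"
    using assms(2-) by blast+
  with assms(1) show ?thesis
    unfolding clause_def by (elim conjE disjE) simp_all
qed

lemma justifiedI:
  assumes "clause A e x y f g p k u v w t"
    and "f < B" "g < B" "p < B" "k < B" "u < B" "v < B" "w < B" "t < B"
  shows "justified B A e x y"
  unfolding justified_def using assms
  by - (rule exI[of _ f], rule conjI, assumption,
    rule exI[of _ g], rule conjI, assumption,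
    rule exI[of _ p], rule conjI, assumption,
    rule exI[of _ k], rule conjI, assumption,
    rule exI[of _ u], rule conjI, assumption,
    rule exI[of _ v], rule conjI, assumption,
    rule exI[of _ w], rule conjI, assumption,
    rule exI[of _ t], rule conjI, assumption)

lemma justified_mono:
  assumes "justified B A e x y" "\<And>e x y. e < B \<Longrightarrow> x < B \<Longrightarrow> y < B \<Longrightarrow> A e x y \<Longrightarrow> A' e x y"
    and "e < B" "x < B" "y < B" "B \<le> B'"
  shows "justified B' A' e x y"
proof -
  obtain f g p k u v w t where *: "clause A e x y f g p k u v w t"
    and b: "f < B" "g < B" "p < B" "k < B" "u < B" "v < B" "w < B" "t < B"
    using assms(1) unfolding justified_def by blast
  show ?thesis
  proof (rule justifiedI)
    show "clause A' e x y f g p k u v w t"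
      by (rule clause_mono[OF * assms(2)]) (use assms(3-5) b in auto)
  qed (use b assms(6) in auto)
qed

lemma stage_mono_bound: "stage B h e x y \<Longrightarrow> B \<le> B' \<Longrightarrow> stage B' h e x y"
proof (induction h arbitrary: e x y)
  case (Suc h)
  then have "justified B' (stage B' h) e x y"
    by (auto intro: justified_mono)
  with Suc.prems show ?case by auto
qed simp

lemma stage_Suc: "stage B h e x y \<Longrightarrow> stage B (Suc h) e x y"
proof (induction h arbitrary: e x y)
  case (Suc h)
  then have "justified B (stage B (Suc h)) e x y"
    using justified_mono[of B "stage B h" e x y "stage B (Suc h)" B] by simp
  with Suc.prems show ?case by simp
qed simp

lemma stage_mono: "stage B h e x y \<Longrightarrow> B \<le> B' \<Longrightarrow> h \<le> h' \<Longrightarrow> stage B' h' e x y"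
  using lift_Suc_mono_le[of "\<lambda>h. stage B' h e x y" h h'] stage_Suc stage_mono_bound
  by (auto simp: le_bool_def)

text \<open>The code \<open>e\<close> determines the opcode, so only clauses with the same opcode
  compete. The two search clauses exclude each other because the tested program cannot output both 0
  and a positive number.\<close>

lemma clause_functional:
  assumes "\<And>e x y y'. A e x y \<Longrightarrow> A e x y' \<Longrightarrow> y = y'"
    and "clause A e x y f g p k u v w t" "clause A e x y' f' g' p' k' u' v' w' t'"
  shows "y = y'"
proof -
  have *: "f' = f" "g' = g" "p' = p" "k' = k"
    using assms(2,3) by (auto simp: clause_def)
  note fn = assms(1)[of f x u u'] assms(1)[of g x v v'] assms(1)[of f x 0 w] assms(1)[of f x 0 w']
    assms(1)[of f x w 0]
    assms(1)[of g u y y'] assms(1)[of e t y y']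
  show ?thesis
    using assms(2,3) fn unfolding clause_def * by (elim conjE disjE) auto
qed

lemma stage_functional: "stage B h e x y \<Longrightarrow> stage B h e x y' \<Longrightarrow> y = y'"
proof (induction h arbitrary: e x y y')
  case (Suc h)
  then show ?case
    using clause_functional[of "stage B h"] unfolding stage.simps justified_def by metis
qed simp

lemma outputs_functional: "outputs e x y \<Longrightarrow> outputs e x y' \<Longrightarrow> y = y'"
  unfolding outputs_def
  by (meson stage_functional stage_mono max.cobounded1 max.cobounded2)

lemma uniform_bound:
  fixes P :: "'a \<Rightarrow> nat \<Rightarrow> bool"
  assumes "finite S" "\<And>z. z \<in> S \<Longrightarrow> \<exists>n. P z n" "\<And>z n n'. P z n \<Longrightarrow> n \<le> n' \<Longrightarrow> P z n'"
  shows "\<exists>n. \<forall>z\<in>S. P z n"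
  using assms
proof (induction rule: finite_induct)
  case (insert z S)
  obtain n where n: "\<forall>z\<in>S. P z n" using insert.IH insert.prems by blast
  obtain m where m: "P z m" using insert.prems(1) by blast
  show ?case
  proof (intro exI ballI)
    show "P y (max n m)" if "y \<in> insert z S" for y
      using that n m insert.prems(2)[of y _ "max n m"] by auto
  qed
qed simp

lemma outputs_bounded: "\<exists>n. \<forall>e<B. \<forall>x<B. \<forall>y<B. outputs e x y \<longrightarrow> stage n n e x y"
proof -
  let ?P = "\<lambda>z n. outputs (fst z) (fst (snd z)) (snd (snd z)) \<longrightarrow> stage n n (fst z) (fst (snd z)) (snd (snd z))"
  have "\<exists>n. \<forall>z\<in>{..<B} \<times> {..<B} \<times> {..<B}. ?P z n"
  proof (rule uniform_bound)
    show "\<exists>n. ?P z n" for z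
      unfolding outputs_def by (meson stage_mono max.cobounded1 max.cobounded2)
    show "?P z n'" if "?P z n" "n \<le> n'" for z n n'
      using that stage_mono by blast
  qed simp
  then show ?thesis by auto
qed

text \<open>A clause mentions finitely many numbers, so by \<open>outputs_bounded\<close> all its
  premises already occur in one common stage; the conclusion then enters at the next height.\<close>

lemma outputs_intro:
  assumes "clause outputs e x y f g p k u v w t"
  shows "outputs e x y"
proof -
  define B where "B = Suc (e + x + y + f + g + p + k + u + v + w + t)"
  obtain B' where *: "\<forall>e<B. \<forall>x<B. \<forall>y<B. outputs e x y \<longrightarrow> stage B' B' e x y"
    using outputs_bounded by blast
  have "justified B outputs e x y"
    by (rule justifiedI[OF assms]) (simp_all add: B_def)
  then have "justified (max B B') (stage (max B B') B') e x y"
  proof (rule justified_mono)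
    show "stage (max B B') B' e x y" if "e < B" "x < B" "y < B" "outputs e x y" for e x y
      using * that stage_mono_bound[OF _ max.cobounded2] by blast
  qed (simp_all add: B_def)
  then have "stage (max B B') (Suc B') e x y"
    by (auto simp: B_def)
  then show ?thesis unfolding outputs_def by blast
qed

section \<open>Closure properties of the computable functions\<close>

definition computable :: "(nat \<Rightarrow> nat) \<Rightarrow> bool" where
  "computable f \<longleftrightarrow> (\<exists>e. \<forall>i. outputs e i (f i))"

lemma outputs_id: "outputs 0 i i"
proof -
  have "0 = pr (pr 0 0) 0" by (simp add: prod_encode_def)
  then show ?thesis
    by (intro outputs_intro[of 0 i i 0 0 "pr 0 0" 0]) (simp add: clause_def)
qed

lemma computable_id: "computable (\<lambda>i. i)"
  using outputs_id unfolding computable_def by blast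

lemma computable_fst: "computable (\<lambda>i. fst (prod_decode i))"
proof -
  have "outputs (pr (pr 0 0) 1) i (fst (prod_decode i))" for i
    by (rule outputs_intro[of _ _ _ 0 0 "pr 0 0" 1 "snd (prod_decode i)"]) (simp add: clause_def)
  then show ?thesis unfolding computable_def by blast
qed

lemma computable_snd: "computable (\<lambda>i. snd (prod_decode i))"
proof -
  have "outputs (pr (pr 0 0) 2) i (snd (prod_decode i))" for i
    by (rule outputs_intro[of _ _ _ 0 0 "pr 0 0" 2 "fst (prod_decode i)"]) (simp add: clause_def)
  then show ?thesis unfolding computable_def by blast
qed

lemma computable_comp:
  assumes "computable f" "computable g"
  shows "computable (\<lambda>i. f (g i))"
proof -
  obtain a b where "\<And>i. outputs a i (f i)" "\<And>i. outputs b i (g i)"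
    using assms unfolding computable_def by blast
  then have "outputs (pr (pr b a) 3) i (f (g i))" for i
    by (intro outputs_intro[of _ _ _ b a "pr b a" 3 "g i"]) (simp add: clause_def)
  then show ?thesis unfolding computable_def by blast
qed

lemma
  assumes "computable f" "computable g"
  shows computable_add: "computable (\<lambda>i. f i + g i)"
    and computable_mult: "computable (\<lambda>i. f i * g i)"
    and computable_pair: "computable (\<lambda>i. pr (f i) (g i))"
    and computable_le: "computable (\<lambda>i. of_bool (f i \<le> g i))"
proof -
  obtain a b where ab: "\<And>i. outputs a i (f i)" "\<And>i. outputs b i (g i)"
    using assms unfolding computable_def by blast
  have *: "computable h" if "\<And>i. clause outputs (pr (pr a b) k) i (h i) a b (pr a b) k (f i) (g i) 0 0" for h k
    unfolding computable_def using outputs_intro[OF that] by blast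
  show "computable (\<lambda>i. f i + g i)"
    by (rule *[of 4]) (simp add: clause_def ab)
  show "computable (\<lambda>i. f i * g i)"
    by (rule *[of 5]) (simp add: clause_def ab)
  show "computable (\<lambda>i. pr (f i) (g i))"
    by (rule *[of 6]) (simp add: clause_def ab)
  show "computable (\<lambda>i. of_bool (f i \<le> g i))"
    by (rule *[of 7]) (auto simp: clause_def ab)
qed

text \<open>There is no opcode for constants: 1 arises as the test \<open>i \<le> i\<close> and 0 as
  the test \<open>1 + 1 \<le> 1\<close>; sums of ones give the rest.\<close>

lemma computable_const: "computable (\<lambda>i. n)"
proof -
  have 1: "computable (\<lambda>i. 1)"
    using computable_le[OF computable_id computable_id] by simp
  have 0: "computable (\<lambda>i. 0)"
    using computable_le[OF computable_add[OF 1 1] 1] by simp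
  show ?thesis
    by (induction n) (use 0 computable_add[OF 1] in auto)
qed

text \<open>The search program \<open>c\<close> gives the right answer from every starting point up
  to the least zero, by induction downwards from that zero. Composition with the program for
  \<open>pr i 0\<close> starts the search at 0.\<close>

lemma computable_Least:
  assumes "computable f" and ex: "\<And>i. \<exists>z. f (pr i z) = 0"
  shows "computable (\<lambda>i. LEAST z. f (pr i z) = 0)"
proof -
  obtain a where a: "\<And>i. outputs a i (f i)"
    using assms(1) unfolding computable_def by blast
  define c where "c = pr (pr a 0) 8"
  define m where "m i = (LEAST z. f (pr i z) = 0)" for i
  have m0: "f (pr i (m i)) = 0" for i
    unfolding m_def using ex by (rule LeastI_ex)
  have step: "outputs c (pr i z) (m i)" if "z \<le> m i" for i z
    using that
  proof (induction z rule: inc_induct)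
    case base
    show ?case
      by (rule outputs_intro[of _ _ _ a 0 "pr a 0" 8 i "m i"]) (use a[of "pr i (m i)"] m0 in \<open>simp add: clause_def c_def\<close>)
  next
    case (step z)
    have "f (pr i z) \<noteq> 0"
      using step(2) not_less_Least unfolding m_def by blast
    then show ?case
      by (intro outputs_intro[of _ _ _ a 0 "pr a 0" 8 i z "f (pr i z)" "pr i (Suc z)"])
        (use a[of "pr i z"] step(3) in \<open>simp add: clause_def c_def\<close>)
  qed
  obtain b where b: "\<And>i. outputs b i (pr i 0)"
    using computable_pair[OF computable_id computable_const] unfolding computable_def by blast
  have "outputs (pr (pr b c) 3) i (m i)" for i
    by (rule outputs_intro[of _ _ _ b c "pr b c" 3 "pr i 0"]) (simp add: clause_def b step)
  then show ?thesis unfolding computable_def m_def by blast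
qed

lemma computable_tval: "(\<And>n. computable (\<rho> n)) \<Longrightarrow> computable (\<lambda>i. std.tval (\<lambda>n. \<rho> n i) t)"
  by (induction t) (auto intro: computable_const computable_add computable_mult)

lemma case_nat_app: "(\<lambda>n. case_nat f \<rho> n i) = case_nat (f i) (\<lambda>n. \<rho> n i)"
  by (auto simp: fun_eq_iff split: nat.split)

lemma computable_bounded_Least:
  assumes \<rho>: "\<And>n. computable (\<rho> n)"
    and \<phi>: "\<And>\<rho>. (\<And>n. computable (\<rho> n)) \<Longrightarrow> computable (\<lambda>i. of_bool (std.sat (\<lambda>n. \<rho> n i) \<phi>))"
    and ex: "\<And>i. \<exists>z. std.sat (case_nat z (\<lambda>n. \<rho> n i)) \<phi>"
  shows "computable (\<lambda>i. LEAST z. std.sat (case_nat z (\<lambda>n. \<rho> n i)) \<phi>)"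
proof -
  define \<rho>' where "\<rho>' = case_nat (\<lambda>i. snd (prod_decode i)) (\<lambda>n i. \<rho> n (fst (prod_decode i)))"
  \<comment> \<open>The search looks for zeros, so the truth value is complemented.\<close>
  define g :: "nat \<Rightarrow> nat" where "g i = of_bool (of_bool (std.sat (\<lambda>n. \<rho>' n i) \<phi>) \<le> (0::nat))" for i :: nat
  have "computable (\<rho>' n)" for n
    unfolding \<rho>'_def using computable_comp[OF \<rho> computable_fst] computable_snd
    by (auto split: nat.split)
  then have "computable g"
    unfolding g_def by (intro computable_le \<phi> computable_const)
  moreover have "g (pr i z) = 0 \<longleftrightarrow> std.sat (case_nat z (\<lambda>n. \<rho> n i)) \<phi>" for i z
    by (simp add: g_def \<rho>'_def case_nat_app)
  ultimately show ?thesis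
    using computable_Least[of g] ex by simp
qed

text \<open>Weakening \<open>Q z\<close> to \<open>z < t \<longrightarrow> Q z\<close> makes
  \<open>t\<close> itself a solution, so the search always halts; it gets as far as \<open>t\<close>
  exactly when there is no solution below.\<close>

lemma le_bounded_Least_iff:
  fixes t :: nat
  shows "t \<le> (LEAST z. z < t \<longrightarrow> Q z) \<longleftrightarrow> (\<forall>z<t. \<not> Q z)"
proof
  assume *: "t \<le> (LEAST z. z < t \<longrightarrow> Q z)"
  show "\<forall>z<t. \<not> Q z"
  proof (intro allI impI notI)
    fix z assume "z < t" "Q z"
    then have "(LEAST z. z < t \<longrightarrow> Q z) \<le> z"
      by (intro Least_le) simp
    with * \<open>z < t\<close> show False by simp
  qed
next
  assume *: "\<forall>z<t. \<not> Q z"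
  have "(LEAST z. z < t \<longrightarrow> Q z) < t \<longrightarrow> Q (LEAST z. z < t \<longrightarrow> Q z)"
    by (rule LeastI[of "\<lambda>z. z < t \<longrightarrow> Q z" t]) simp
  with * show "t \<le> (LEAST z. z < t \<longrightarrow> Q z)"
    using leI by blast
qed

text \<open>On truth values 0 and 1, implication is the test \<open>\<le>\<close> and negation is
  the test \<open>\<le> 0\<close>. A bounded quantifier becomes a comparison of the bound with the
  result of a search, for a counterexample under \<open>BAll\<close> and for a witness under
  \<open>BEx\<close>.\<close>

lemma computable_Delta0:
  assumes "is_Delta0 \<phi>" "\<And>n. computable (\<rho> n)"
  shows "computable (\<lambda>i. of_bool (std.sat (\<lambda>n. \<rho> n i) \<phi>))"
  using assms
proof (induction arbitrary: \<rho> rule: is_Delta0.induct)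
  case (1 s t)
  have "computable (\<lambda>i. of_bool (std.tval (\<lambda>n. \<rho> n i) s \<le> std.tval (\<lambda>n. \<rho> n i) t) *
      of_bool (std.tval (\<lambda>n. \<rho> n i) t \<le> std.tval (\<lambda>n. \<rho> n i) s))"
    by (intro computable_mult computable_le computable_tval 1)
  moreover have "of_bool (a \<le> b) * of_bool (b \<le> a) = (of_bool (a = b) :: nat)" for a b :: nat
    by auto
  ultimately show ?case by simp
next
  case (2 s t)
  have "computable (\<lambda>i. of_bool (of_bool (std.tval (\<lambda>n. \<rho> n i) t \<le> std.tval (\<lambda>n. \<rho> n i) s) \<le> (0::nat)))"
    by (intro computable_le computable_tval computable_const 2)
  moreover have "of_bool (of_bool (b \<le> a) \<le> (0::nat)) = (of_bool (a < b) :: nat)" for a b :: nat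
    by auto
  ultimately show ?case by simp
next
  case 3
  show ?case using computable_const[of 0] by simp
next
  case (4 \<phi> \<psi>)
  have "computable (\<lambda>i. of_bool (of_bool (std.sat (\<lambda>n. \<rho> n i) \<phi>) \<le> (of_bool (std.sat (\<lambda>n. \<rho> n i) \<psi>) :: nat)))"
    by (intro computable_le 4)
  moreover have "of_bool (of_bool P \<le> (of_bool Q :: nat)) = (of_bool (P \<longrightarrow> Q) :: nat)" for P Q
    by auto
  ultimately show ?case by simp
next
  case (5 \<phi> t)
  let ?\<psi> = "Imp (Less (Var 0) (shift 1 t)) (Neg \<phi>)"
  let ?m = "\<lambda>i. LEAST z. std.sat (case_nat z (\<lambda>n. \<rho> n i)) ?\<psi>"
  have ex: "\<exists>z. std.sat (case_nat z (\<lambda>n. \<rho> n i)) ?\<psi>" for i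
    by (auto intro!: exI[of _ "std.tval (\<lambda>n. \<rho> n i) t"])
  have \<psi>: "computable (\<lambda>i. of_bool (std.sat (\<lambda>n. \<rho> n i) ?\<psi>))" if "\<And>n. computable (\<rho> n)" for \<rho>
  proof -
    have "computable (\<lambda>i. of_bool (of_bool (of_bool (std.tval (\<lambda>n. \<rho> n i) (shift 1 t) \<le> \<rho> 0 i) \<le> (0::nat)) \<le>
        (of_bool (of_bool (std.sat (\<lambda>n. \<rho> n i) \<phi>) \<le> (0::nat)) :: nat)))"
      by (intro computable_le computable_tval computable_const 5 that)
    moreover have "of_bool (of_bool (of_bool (b \<le> a) \<le> (0::nat)) \<le> (of_bool (of_bool P \<le> (0::nat)) :: nat)) =
       (of_bool (a < b \<longrightarrow> \<not> P) :: nat)" for a b :: nat and P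
      by auto
    ultimately show ?thesis by simp
  qed
  have "computable ?m"
    by (rule computable_bounded_Least[OF 5(3) \<psi> ex])
  then have "computable (\<lambda>i. of_bool (std.tval (\<lambda>n. \<rho> n i) t \<le> ?m i))"
    by (intro computable_le computable_tval 5)
  moreover have "std.tval (\<lambda>n. \<rho> n i) t \<le> ?m i \<longleftrightarrow> std.sat (\<lambda>n. \<rho> n i) (BAll t \<phi>)" for i
    by (simp add: le_bounded_Least_iff)
  ultimately show ?case by simp
next
  case (6 \<phi> t)
  let ?\<psi> = "Imp (Less (Var 0) (shift 1 t)) \<phi>"
  let ?m = "\<lambda>i. LEAST z. std.sat (case_nat z (\<lambda>n. \<rho> n i)) ?\<psi>"
  have ex: "\<exists>z. std.sat (case_nat z (\<lambda>n. \<rho> n i)) ?\<psi>" for i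
    by (auto intro!: exI[of _ "std.tval (\<lambda>n. \<rho> n i) t"])
  have \<psi>: "computable (\<lambda>i. of_bool (std.sat (\<lambda>n. \<rho> n i) ?\<psi>))" if "\<And>n. computable (\<rho> n)" for \<rho>
  proof -
    have "computable (\<lambda>i. of_bool (of_bool (of_bool (std.tval (\<lambda>n. \<rho> n i) (shift 1 t) \<le> \<rho> 0 i) \<le> (0::nat)) \<le>
        (of_bool (std.sat (\<lambda>n. \<rho> n i) \<phi>) :: nat)))"
      by (intro computable_le computable_tval computable_const 6 that)
    moreover have "of_bool (of_bool (of_bool (b \<le> a) \<le> (0::nat)) \<le> (of_bool P :: nat)) =
       (of_bool (a < b \<longrightarrow> P) :: nat)" for a b :: nat and P
      by auto
    ultimately show ?thesis by simp
  qed
  have "computable ?m"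
    by (rule computable_bounded_Least[OF 6(3) \<psi> ex])
  then have "computable (\<lambda>i. of_bool (of_bool (std.tval (\<lambda>n. \<rho> n i) t \<le> ?m i) \<le> (0::nat)))"
    by (intro computable_le computable_tval computable_const 6)
  moreover have "of_bool (of_bool (std.tval (\<lambda>n. \<rho> n i) t \<le> ?m i) \<le> (0::nat))
      = (of_bool (std.sat (\<lambda>n. \<rho> n i) (BEx t \<phi>)) :: nat)" for i
    by (simp add: le_bounded_Least_iff)
  ultimately show ?case by simp
qed

subsection \<open>A universal formula\<close>

primrec numeral_tm :: "nat \<Rightarrow> tm" where
  "numeral_tm 0 = Zero"
| "numeral_tm (Suc n) = Add (numeral_tm n) One"

lemma std_numeral_tm [simp]: "std.tval \<rho> (numeral_tm n) = n"
  by (induction n) auto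

text \<open>Positional notation in base \<open>B\<close>, hence injective once the first three
  digits are below \<open>B\<close> (\<open>cell_inject\<close>).\<close>

definition cell :: "nat \<Rightarrow> nat \<Rightarrow> nat \<Rightarrow> nat \<Rightarrow> nat \<Rightarrow> nat" where
  "cell B h e x y = h + B * (e + B * (x + B * y))"

text \<open>
  A finite set of quadruples of numbers below \<open>B\<close> is coded by \<open>a\<close> and \<open>b\<close>: membership means that
  the value of Goedel's beta function at the cell of the quadruple is \<open>0\<close>.
\<close>

definition table :: "nat \<Rightarrow> nat \<Rightarrow> nat \<Rightarrow> nat \<Rightarrow> nat \<Rightarrow> nat \<Rightarrow> nat \<Rightarrow> bool" where
  "table a b B h e x y \<longleftrightarrow> 1 + (cell B h e x y + 1) * b dvd a"

definition table_fm :: "tm \<Rightarrow> tm \<Rightarrow> tm \<Rightarrow> tm \<Rightarrow> tm \<Rightarrow> tm \<Rightarrow> tm \<Rightarrow> fm" where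
  "table_fm a b B h e x y = BEx (Succ a) (Eq (shift 1 a) (Mul (Var 0) (shift 1
     (Succ (Mul (Succ (Add h (Mul B (Add e (Mul B (Add x (Mul B y))))))) b)))))"

lemma std_table_fm [simp]:
  "std.sat \<rho> (table_fm a b B h e x y) \<longleftrightarrow>
    table (std.tval \<rho> a) (std.tval \<rho> b) (std.tval \<rho> B) (std.tval \<rho> h) (std.tval \<rho> e) (std.tval \<rho> x) (std.tval \<rho> y)"
proof -
  have "(\<exists>q<Suc n. n = q * m) \<longleftrightarrow> m dvd n" if "0 < m" for n m :: nat
  proof
    assume "m dvd n"
    then obtain q where q: "n = q * m" by (metis dvd_def mult.commute)
    with that have "q < Suc n" by (simp add: less_Suc_eq_le)
    with q show "\<exists>q<Suc n. n = q * m" by blast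
  qed auto
  then show ?thesis
    by (simp add: table_fm_def table_def cell_def Succ_def del: mult_Suc mult_Suc_right)
qed

text \<open>
  \<open>Var 8\<close> is the height of the premises and \<open>Var 12\<close>, \<open>Var 13\<close> are the two heights bound further out.
\<close>

definition clause_fm :: fm where
  "clause_fm = (
    let A = (\<lambda>e x y. table_fm (Var 14) (Var 15) (Var 16) (Var 8) e x y);
        e = Var 11; x = Var 10; y = Var 9; f = Var 7; g = Var 6; p = Var 5; k = Var 4;
        u = Var 3; v = Var 2; w = Var 1; t = Var 0
    in And (pair_fm g f p) (And (pair_fm k p e)
      (Or (And (Eq k (numeral_tm 0)) (Eq y x))
      (Or (And (Eq k (numeral_tm 1)) (pair_fm u y x))
      (Or (And (Eq k (numeral_tm 2)) (pair_fm y u x))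
      (Or (And (Eq k (numeral_tm 3)) (And (A f x u) (A g u y)))
      (Or (And (A f x u) (And (A g x v)
             (Or (And (Eq k (numeral_tm 4)) (Eq y (Add u v)))
             (Or (And (Eq k (numeral_tm 5)) (Eq y (Mul u v)))
             (Or (And (Eq k (numeral_tm 6)) (pair_fm v u y))
             (Or (And (Eq k (numeral_tm 7)) (And (Leq u v) (Eq y One)))
                 (And (Eq k (numeral_tm 7)) (And (Less v u) (Eq y Zero)))))))))
      (Or (And (Eq k (numeral_tm 8)) (And (pair_fm v u x) (And (A f x Zero) (Eq y v))))
          (And (Eq k (numeral_tm 8)) (And (pair_fm v u x) (And (A f x w) (And (Less Zero w)
             (And (pair_fm (Succ v) u t) (A e t y))))))))))))))"

text \<open>\<open>pair_fm\<close> takes the components in the opposite order to \<open>pr\<close>: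
  \<open>pair_fm g f p\<close> expresses \<open>p = pr f g\<close>.\<close>

lemma std_clause_fm:
  "std.sat \<rho> clause_fm \<longleftrightarrow>
    clause (table (\<rho> 14) (\<rho> 15) (\<rho> 16) (\<rho> 8)) (\<rho> 11) (\<rho> 10) (\<rho> 9)
      (\<rho> 7) (\<rho> 6) (\<rho> 5) (\<rho> 4) (\<rho> 3) (\<rho> 2) (\<rho> 1) (\<rho> 0)"
  unfolding clause_fm_def clause_def Let_def std.sat_derived std_pair_fm std_table_fm std.sat.simps
    std.tval.simps std_numeral_tm Succ_def le_eq_less_or_eq
  by simp

text \<open>The bounds \<open>Var 8\<close> to \<open>Var 15\<close> all denote the same number
  \<open>B\<close>, whose index grows under each new quantifier.\<close>

definition justified_fm :: fm where
  "justified_fm = BEx (Var 8) (BEx (Var 9) (BEx (Var 10) (BEx (Var 11) (BEx (Var 12) (BEx (Var 13)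
     (BEx (Var 14) (BEx (Var 15) clause_fm)))))))"

lemma std_justified_fm:
  "std.sat \<rho> justified_fm \<longleftrightarrow> justified (\<rho> 8) (table (\<rho> 6) (\<rho> 7) (\<rho> 8) (\<rho> 0)) (\<rho> 3) (\<rho> 2) (\<rho> 1)"
  unfolding justified_fm_def std.sat_quantifiers std_clause_fm justified_def by simp

text \<open>
  Free variables: 0 to 3 are the height, \<open>a\<close>, \<open>b\<close>, \<open>B\<close>; 4, 5, 6 are program, output, input.
\<close>

definition univ_matrix :: fm where
  "univ_matrix =
    And (Less (Var 0) (Var 3)) (And (Less (Var 4) (Var 3)) (And (Less (Var 6) (Var 3)) (And (Less (Var 5) (Var 3))
    (And (table_fm (Var 1) (Var 2) (Var 3) (Var 0) (Var 4) (Var 6) (Var 5))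
      (BAll (Var 3) (BAll (Var 4) (BAll (Var 5) (BAll (Var 6)
        (Imp (table_fm (Var 5) (Var 6) (Var 7) (Var 3) (Var 2) (Var 1) (Var 0))
          (BEx (Var 3) justified_fm))))))))))"

text \<open>Below the four quantifiers removed here, the program becomes \<open>Var 0\<close>, the
  output \<open>Var 1\<close> and the input the parameter \<open>Var 2\<close>: an approximation for
  this formula bounds the outputs of many programs at one fixed input.\<close>

definition univ_fm :: fm where
  "univ_fm = (Ex ^^ 4) univ_matrix"

lemma is_Sigma_univ_fm: "is_Sigma 1 univ_fm"
proof -
  have "is_Delta0 (pair_fm s t u)" "is_Delta0 (table_fm s t u v w x y)" for s t u v w x y
    by (auto simp: pair_fm_def table_fm_def intro!: is_Delta0_rules)
  then have "is_Delta0 univ_matrix"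
    unfolding univ_matrix_def justified_fm_def clause_fm_def Let_def
    by (intro is_Delta0_rules)
  then show ?thesis
    unfolding univ_fm_def using is_Sigma_is_Pi.intros(3)[of 0 univ_matrix 4] by simp
qed

section \<open>Correctness of the universal formula\<close>

definition computation :: "nat \<Rightarrow> nat \<Rightarrow> nat \<Rightarrow> bool" where
  "computation a b B \<longleftrightarrow> (\<forall>h<B. \<forall>e<B. \<forall>x<B. \<forall>y<B. table a b B h e x y \<longrightarrow>
      (\<exists>h'<h. justified B (table a b B h') e x y))"

lemma std_univ_fm_iff:
  "std.sat \<rho> univ_fm \<longleftrightarrow> (\<exists>B b a h. h < B \<and> \<rho> 0 < B \<and> \<rho> 2 < B \<and> \<rho> 1 < B \<and>
     table a b B h (\<rho> 0) (\<rho> 2) (\<rho> 1) \<and> computation a b B)"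
proof -
  have 4: "(Ex ^^ 4) \<phi> = Ex (Ex (Ex (Ex \<phi>)))" for \<phi>
    by (simp add: numeral_eq_Suc)
  show ?thesis
    unfolding univ_fm_def 4 univ_matrix_def std.sat_derived std.sat_quantifiers std.sat.simps std_justified_fm
      std_table_fm computation_def
    by simp
qed

text \<open>Justifications lead to strictly smaller heights, so local correctness of the table
  suffices, by induction on the height.\<close>

lemma computation_sound:
  assumes "computation a b B"
  shows "h < B \<Longrightarrow> e < B \<Longrightarrow> x < B \<Longrightarrow> y < B \<Longrightarrow> table a b B h e x y \<Longrightarrow> stage B h e x y"
proof (induction h arbitrary: e x y rule: less_induct)
  case (less h)
  then obtain h' where h': "h' < h" "justified B (table a b B h') e x y"
    using assms unfolding computation_def by blast
  then have "justified B (stage B h') e x y"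
    using less by (elim justified_mono) auto
  with less.prems have "stage B (Suc h') e x y" by simp
  with h'(1) show ?case
    by (elim stage_mono) auto
qed

lemma add_mult_inject:
  fixes B :: nat
  assumes "h < B" "h' < B" "h + B * m = h' + B * m'"
  shows "h = h' \<and> m = m'"
proof -
  have "(h + B * m) mod B = h" "(h' + B * m') mod B = h'"
    using assms(1,2) by simp_all
  with assms show ?thesis by auto
qed

lemma cell_inject:
  assumes "h < B" "e < B" "x < B" "h' < B" "e' < B" "x' < B"
    and "cell B h e x y = cell B h' e' x' y'"
  shows "h = h' \<and> e = e' \<and> x = x' \<and> y = y'"
  using assms unfolding cell_def by (metis add_mult_inject)

text \<open>The table records all stages with entries below the bound, not just one computation; its
  local correctness is then the recursion equation of \<open>stage\<close>.\<close>

lemma computation_complete: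
  assumes "stage B h e x y"
  obtains B' b a where "h < B'" "e < B'" "x < B'" "y < B'" "table a b B' h e x y" "computation a b B'"
proof -
  \<comment> \<open>The height is an entry of the table too, so it must also fit below the
    bound.\<close>
  define B' where "B' = B + h + 1"
  have stage: "stage B' h e x y"
    using assms by (rule stage_mono_bound) (simp add: B'_def)
  have "h < B'" by (simp add: B'_def)
  moreover have "e < B' \<and> x < B' \<and> y < B'"
    using stage by (cases h) auto
  \<comment> \<open>The value 0 marks members, since \<open>table\<close> tests for remainder
    0.\<close>
  moreover define c :: "nat \<Rightarrow> nat" where
    "c n = of_bool (\<not> (\<exists>h<B'. \<exists>e<B'. \<exists>x<B'. \<exists>y<B'. n = cell B' h e x y \<and> stage B' h e x y))" for n
  obtain a b where ab: "\<forall>i<Suc (cell B' B' B' B' B'). a mod (1 + (i + 1) * b) = c i"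
    using beta by blast
  have table: "table a b B' h e x y \<longleftrightarrow> stage B' h e x y" if "h < B'" "e < B'" "x < B'" "y < B'" for h e x y
  proof -
    have "cell B' h e x y < Suc (cell B' B' B' B' B')"
      unfolding cell_def less_Suc_eq_le using that by (intro add_mono mult_le_mono2) auto
    then have "table a b B' h e x y \<longleftrightarrow> c (cell B' h e x y) = 0"
      using ab by (simp only: table_def dvd_eq_mod_eq_0)
    also have "\<dots> \<longleftrightarrow> stage B' h e x y"
    proof
      assume "c (cell B' h e x y) = 0"
      then obtain h' e' x' y' where *: "h' < B'" "e' < B'" "x' < B'" "stage B' h' e' x' y'"
        and "cell B' h e x y = cell B' h' e' x' y'"
        by (auto simp: c_def)
      with cell_inject[OF that(1-3) *(1-3)] show "stage B' h e x y"
        by blast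
    next
      assume "stage B' h e x y"
      with that show "c (cell B' h e x y) = 0"
        unfolding c_def of_bool_eq_0_iff not_not by blast
    qed
    finally show ?thesis .
  qed
  have "computation a b B'"
    unfolding computation_def
  proof (intro allI impI)
    fix h e x y assume *: "h < B'" "e < B'" "x < B'" "y < B'" "table a b B' h e x y"
    then have "stage B' h e x y" by (simp add: table)
    then obtain h' where h': "h = Suc h'" "justified B' (stage B' h') e x y"
      by (cases h) auto
    then have "justified B' (table a b B' h') e x y"
      using * by (elim justified_mono) (auto simp: table)
    with h'(1) show "\<exists>h'<h. justified B' (table a b B' h') e x y" by blast
  qed
  ultimately show ?thesis
    using that stage table by blast
qed

lemma std_univ_fm: "std.sat \<rho> univ_fm \<longleftrightarrow> outputs (\<rho> 0) (\<rho> 2) (\<rho> 1)"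
proof
  assume "std.sat \<rho> univ_fm"
  then show "outputs (\<rho> 0) (\<rho> 2) (\<rho> 1)"
    unfolding std_univ_fm_iff outputs_def by (blast dest: computation_sound)
next
  assume "outputs (\<rho> 0) (\<rho> 2) (\<rho> 1)"
  then show "std.sat \<rho> univ_fm"
    unfolding std_univ_fm_iff outputs_def by (metis computation_complete)
qed

subsection \<open>The restricted ultrapower\<close>

text \<open>Finer filters are smaller in the order of filters, so Zorn's lemma is applied downwards:
  an ultrafilter is a minimal proper filter, and lying below \<open>sequentially\<close> makes it
  free.\<close>

lemma exists_free_ultrafilter:
  "\<exists>U :: nat filter. U \<noteq> bot \<and> U \<le> sequentially \<and>
    (\<forall>P. eventually P U \<or> eventually (\<lambda>i. \<not> P i) U)"
proof -
  define \<A> :: "nat filter set" where "\<A> = {F. F \<noteq> bot \<and> F \<le> sequentially}"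
  have "\<exists>m\<in>\<A>. \<forall>a\<in>\<A>. m \<ge> a \<longrightarrow> a = m"
  proof (rule predicate_Zorn)
    show "partial_order_on \<A> (relation_of (\<ge>) \<A>)"
      by (auto intro: partial_order_on_relation_ofI)
    show "\<exists>u\<in>\<A>. \<forall>a\<in>C. u \<le> a" if C: "C \<in> Chains (relation_of (\<ge>) \<A>)" for C
    proof (cases "C = {}")
      case True
      have "sequentially \<in> \<A>" by (simp add: \<A>_def)
      with True show ?thesis by blast
    next
      case False
      have sub: "C \<subseteq> \<A>" and chain: "\<And>a b. a \<in> C \<Longrightarrow> b \<in> C \<Longrightarrow> a \<le> b \<or> b \<le> a"
        using C by (auto simp: Chains_def relation_of_def)
      \<comment> \<open>Each finite part of a chain is bounded below by a member of the chain, which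
        is proper; this keeps the infimum of the whole chain proper.\<close>
      have "\<exists>b\<in>C. b \<le> Inf X" if "finite X" "X \<subseteq> C" for X
        using that
      proof (induction rule: finite_induct)
        case empty
        with False show ?case by auto
      next
        case (insert a X)
        then obtain b where "b \<in> C" "b \<le> Inf X" by auto
        with insert.prems chain[of a b] show ?case
          by (auto intro: order_trans)
      qed
      note lower = this
      have "Inf C \<noteq> bot"
      proof (rule Inf_filter_not_bot)
        fix X assume "X \<subseteq> C" "finite X"
        then obtain b where "b \<in> C" "b \<le> Inf X" using lower by blast
        moreover have "b \<noteq> bot" using \<open>b \<in> C\<close> sub by (auto simp: \<A>_def)
        ultimately show "Inf X \<noteq> bot" using le_bot by fastforce
      qed
      moreover have "Inf C \<le> sequentially"
      proof -
        obtain a where "a \<in> C" using False by blast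
        then show ?thesis using sub Inf_lower2[of a C sequentially] by (auto simp: \<A>_def)
      qed
      ultimately show ?thesis
        by (intro bexI[of _ "Inf C"]) (auto simp: \<A>_def intro: Inf_lower)
    qed
  qed
  then obtain U where U: "U \<in> \<A>" and min: "\<And>F. F \<in> \<A> \<Longrightarrow> F \<le> U \<Longrightarrow> F = U"
    by blast
  have "eventually P U" if "\<not> eventually (\<lambda>i. \<not> P i) U" for P
  proof -
    \<comment> \<open>Adding the set where \<open>P\<close> holds leaves the filter proper, so
      minimality of \<open>U\<close> forces that set into \<open>U\<close>.\<close>
    let ?F = "inf U (principal {i. P i})"
    have "?F \<noteq> bot"
      using that by (simp add: trivial_limit_def eventually_inf_principal)
    moreover have "?F \<le> sequentially"
      using U by (auto simp: \<A>_def intro: le_infI1)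
    ultimately have "?F = U"
      by (intro min) (simp_all add: \<A>_def)
    moreover have "eventually P ?F"
      by (simp add: eventually_inf_principal)
    ultimately show ?thesis by simp
  qed
  with U show ?thesis by (auto simp: \<A>_def)
qed

section \<open>Computable Skolem functions\<close>

primrec component :: "nat \<Rightarrow> nat \<Rightarrow> nat" where
  "component 0 z = fst (prod_decode z)"
| "component (Suc j) z = component j (snd (prod_decode z))"

lemma computable_component: "computable (component j)"
  by (induction j) (simp_all add: computable_fst computable_comp[OF _ computable_snd])

lemma component_surj: "\<exists>z. \<forall>j<k. component j z = v j"
proof (induction k arbitrary: v)
  case (Suc k)
  obtain z where z: "\<forall>j<k. component j z = v (Suc j)"
    using Suc.IH[of "\<lambda>j. v (Suc j)"] by blast
  have "component j (pr (v 0) z) = v j" if "j < Suc k" for j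
    using z that by (cases j) auto
  then show ?case by blast
qed simp

text \<open>Since iterated pairing packs a whole block of witnesses into one number, a single search
  for the least code suffices. It halts by \<open>ex\<close>, and its test is computable because
  \<open>\<delta>\<close> is \<Delta>0.\<close>

lemma skolem:
  assumes \<delta>: "is_Delta0 \<delta>" and \<rho>: "\<And>n. computable (\<rho> n)"
    and ex: "\<And>i. std.sat (\<lambda>n. \<rho> n i) ((Ex ^^ k) \<delta>)"
  shows "\<exists>v. (\<forall>j. computable (v j)) \<and> (\<forall>i. std.sat (\<lambda>n. if n < k then v n i else \<rho> (n - k) i) \<delta>)"
proof -
  define \<rho>' where "\<rho>' n = (if n < k then (\<lambda>m. component n (snd (prod_decode m)))
    else (\<lambda>m. \<rho> (n - k) (fst (prod_decode m))))" for n
  define S where "S i z \<longleftrightarrow> std.sat (\<lambda>n. if n < k then component n z else \<rho> (n - k) i) \<delta>" for i z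
  define f :: "nat \<Rightarrow> nat" where "f m = of_bool (of_bool (std.sat (\<lambda>n. \<rho>' n m) \<delta>) \<le> (0::nat))" for m
  have "computable (\<rho>' n)" for n
    unfolding \<rho>'_def using computable_comp[OF \<rho> computable_fst] computable_comp[OF computable_component computable_snd]
    by auto
  then have f: "computable f"
    unfolding f_def by (intro computable_le computable_Delta0 \<delta> computable_const)
  have f0: "f (pr i z) = 0 \<longleftrightarrow> S i z" for i z
  proof -
    have "(\<lambda>n. \<rho>' n (pr i z)) = (\<lambda>n. if n < k then component n z else \<rho> (n - k) i)"
      by (auto simp: \<rho>'_def)
    then show ?thesis by (simp add: f_def S_def)
  qed
  have S: "\<exists>z. S i z" for i
  proof -
    obtain v where v: "std.sat (\<lambda>n. if n < k then v n else \<rho> (n - k) i) \<delta>"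
      using ex[of i] unfolding std.sat_Ex_pow by blast
    obtain z where "\<forall>j<k. component j z = v j" using component_surj by blast
    then have "(\<lambda>n. if n < k then component n z else \<rho> (n - k) i) = (\<lambda>n. if n < k then v n else \<rho> (n - k) i)"
      by auto
    with v have "S i z" by (simp add: S_def)
    then show ?thesis ..
  qed
  define m where "m i = (LEAST z. S i z)" for i
  have "computable m"
    using computable_Least[OF f] S unfolding f0 m_def by blast
  then have "computable (\<lambda>i. component j (m i))" for j
    by (rule computable_comp[OF computable_component])
  moreover have "S i (m i)" for i
    unfolding m_def using S by (rule LeastI_ex)
  ultimately show ?thesis
    unfolding S_def by (intro exI[of _ "\<lambda>j i. component j (m i)"]) simp
qed

lemma skolem_Ex:
  assumes "is_Delta0 \<delta>" "\<And>n. computable (\<rho> n)"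
    and "\<And>i. \<exists>z. std.sat (case_nat z (\<lambda>n. \<rho> n i)) \<delta>"
  obtains g where "computable g" "\<And>i. std.sat (case_nat (g i) (\<lambda>n. \<rho> n i)) \<delta>"
proof -
  have "(\<lambda>n. if n < 1 then v n i else \<rho> (n - 1) i) = case_nat (v 0 i) (\<lambda>n. \<rho> n i)" for v :: "nat \<Rightarrow> nat \<Rightarrow> nat" and i
    by (auto simp: fun_eq_iff split: nat.split)
  moreover have "std.sat (\<lambda>n. \<rho> n i) ((Ex ^^ 1) \<delta>)" for i
    using assms(3) by simp
  then obtain v where "\<And>j. computable (v j)" "\<And>i. std.sat (\<lambda>n. if n < 1 then v n i else \<rho> (n - 1) i) \<delta>"
    using skolem[of \<delta> \<rho> 1, OF assms(1,2)] by blast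
  ultimately show thesis
    by (intro that[of "v 0"]) simp_all
qed

definition entry :: "nat \<Rightarrow> nat \<Rightarrow> nat \<Rightarrow> bool" where
  "entry s i r \<longleftrightarrow> (\<exists>l a b. s = pr l (pr b a) \<and> r = a mod (1 + (i + 1) * b))"

text \<open>Every number codes a sequence and the beta function has a value at every index, even
  beyond the length; so the entry is a total function of \<open>i\<close>.\<close>

lemma computable_entry:
  assumes "computable s"
  obtains u where "computable u" "\<And>i. entry (s i) j (u i)"
proof -
  have "\<exists>z. std.sat (case_nat z (\<lambda>n. s i)) (entry_fm (Var 1) (numeral_tm j) (Var 0))" for i
    by (auto simp: surj_pair) (metis prod_decode_inverse surj_pair)
  then obtain u where "computable u" "\<And>i. std.sat (case_nat (u i) (\<lambda>n. s i)) (entry_fm (Var 1) (numeral_tm j) (Var 0))"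
    using skolem_Ex[of "entry_fm (Var 1) (numeral_tm j) (Var 0)" "\<lambda>n. s"] assms is_Delta0_entry by blast
  then show thesis
    by (intro that) (simp_all add: entry_def)
qed

section \<open>The ultrapower, Los' theorem and transfer\<close>

locale ultrapower =
  fixes U :: "nat filter"
  assumes nonbot: "U \<noteq> bot"
    and free: "U \<le> sequentially"
    and ultra: "eventually P U \<or> eventually (\<lambda>i. \<not> P i) U"
begin

sublocale up: fo_structure "Collect computable" "\<lambda>f g. \<forall>\<^sub>F i in U. f i = g i" "\<lambda>f g. \<forall>\<^sub>F i in U. f i < g i"
  "\<lambda>_. 0" "\<lambda>_. Suc 0" "\<lambda>f g i. f i + g i" "\<lambda>f g i. f i * g i"
proof
  show "\<forall>\<^sub>F i in U. f i = h i" if "\<forall>\<^sub>F i in U. f i = g i" "\<forall>\<^sub>F i in U. g i = h i" for f g h :: "nat \<Rightarrow> nat"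
    using that by eventually_elim simp
  show "\<forall>\<^sub>F i in U. f i + g i = f' i + g' i" if "\<forall>\<^sub>F i in U. f i = f' i" "\<forall>\<^sub>F i in U. g i = g' i"
    for f g f' g' :: "nat \<Rightarrow> nat"
    using that by eventually_elim simp
  show "\<forall>\<^sub>F i in U. f i * g i = f' i * g' i" if "\<forall>\<^sub>F i in U. f i = f' i" "\<forall>\<^sub>F i in U. g i = g' i"
    for f g f' g' :: "nat \<Rightarrow> nat"
    using that by eventually_elim simp
  show "\<forall>\<^sub>F i in U. f' i < g' i" if "\<forall>\<^sub>F i in U. f i = f' i" "\<forall>\<^sub>F i in U. g i = g' i" "\<forall>\<^sub>F i in U. f i < g i"
    for f g f' g' :: "nat \<Rightarrow> nat"
    using that by eventually_elim simp
qed (auto simp: computable_const computable_add computable_mult eq_commute)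

lemma not_eventually_iff: "\<not> eventually P U \<longleftrightarrow> eventually (\<lambda>i. \<not> P i) U"
proof
  assume "eventually (\<lambda>i. \<not> P i) U"
  show "\<not> eventually P U"
  proof
    assume "eventually P U"
    with \<open>eventually (\<lambda>i. \<not> P i) U\<close> have "eventually (\<lambda>_. False) U"
      by eventually_elim simp
    with nonbot show False by (simp add: trivial_limit_def)
  qed
qed (use ultra in blast)

lemma eventually_imp_iff: "(\<forall>\<^sub>F i in U. P i \<longrightarrow> Q i) \<longleftrightarrow> (eventually P U \<longrightarrow> eventually Q U)"
proof
  assume "eventually P U \<longrightarrow> eventually Q U"
  then consider "eventually (\<lambda>i. \<not> P i) U" | "eventually Q U"
    using not_eventually_iff by blast
  then show "\<forall>\<^sub>F i in U. P i \<longrightarrow> Q i"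
    by cases (auto elim: eventually_mono)
qed (auto elim: eventually_rev_mp)

lemma tval_up: "up.tval \<rho> t = (\<lambda>i. std.tval (\<lambda>n. \<rho> n i) t)"
  by (induction t) auto

lemma up_env_iff: "up.env \<rho> \<longleftrightarrow> (\<forall>n. computable (\<rho> n))"
  by (simp add: up.env_def)

text \<open>The critical case is \<open>BEx\<close>, where almost everywhere existing witnesses must
  be collected into one computable function. \<open>BAll\<close> is reduced to it by negation, which
  commutes with an ultrafilter.\<close>

lemma Los:
  assumes "is_Delta0 \<phi>" "\<And>n. computable (\<rho> n)"
  shows "up.sat \<rho> \<phi> \<longleftrightarrow> (\<forall>\<^sub>F i in U. std.sat (\<lambda>n. \<rho> n i) \<phi>)"
proof -
  have BEx_step: "up.sat \<rho> (BEx t \<phi>) \<longleftrightarrow> (\<forall>\<^sub>F i in U. std.sat (\<lambda>n. \<rho> n i) (BEx t \<phi>))"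
    if "is_Delta0 \<phi>" and IH: "\<And>\<rho>. (\<And>n. computable (\<rho> n)) \<Longrightarrow> up.sat \<rho> \<phi> \<longleftrightarrow> (\<forall>\<^sub>F i in U. std.sat (\<lambda>n. \<rho> n i) \<phi>)"
      and \<rho>: "\<And>n. computable (\<rho> n)" for \<phi> \<rho> t
  proof
    have comp: "computable (case_nat x \<rho> n)" if "computable x" for x n
      using that \<rho> by (simp split: nat.split)
    show "\<forall>\<^sub>F i in U. std.sat (\<lambda>n. \<rho> n i) (BEx t \<phi>)" if up: "up.sat \<rho> (BEx t \<phi>)"
    proof -
      obtain x where x: "computable x" "\<forall>\<^sub>F i in U. x i < std.tval (\<lambda>n. \<rho> n i) t" "up.sat (case_nat x \<rho>) \<phi>"
        using up by (auto simp: tval_up)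
      from x(3) have "\<forall>\<^sub>F i in U. std.sat (case_nat (x i) (\<lambda>n. \<rho> n i)) \<phi>"
        by (simp only: IH[OF comp[OF x(1)]] case_nat_app)
      with x(2) show ?thesis
        by eventually_elim auto
    qed
    show "up.sat \<rho> (BEx t \<phi>)" if *: "\<forall>\<^sub>F i in U. std.sat (\<lambda>n. \<rho> n i) (BEx t \<phi>)"
    proof -
      \<comment> \<open>The premise makes the search succeed also at the indices where the bounded
        existential formula fails, so that the Skolem function is total.\<close>
      let ?\<psi> = "Imp (lift (BEx t \<phi>)) (And (Less (Var 0) (shift 1 t)) \<phi>)"
      have \<psi>: "is_Delta0 ?\<psi>"
        unfolding lift_def by (intro is_Delta0_rules is_Delta0_subst \<open>is_Delta0 \<phi>\<close>)
      have ex: "\<exists>z. std.sat (case_nat z (\<lambda>n. \<rho> n i)) ?\<psi>" for i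
        by (auto simp: std.sat_lift)
      obtain g where g: "computable g" "\<And>i. std.sat (case_nat (g i) (\<lambda>n. \<rho> n i)) ?\<psi>"
        using skolem_Ex[OF \<psi> \<rho> ex] by blast
      have "\<forall>\<^sub>F i in U. g i < std.tval (\<lambda>n. \<rho> n i) t \<and> std.sat (case_nat (g i) (\<lambda>n. \<rho> n i)) \<phi>"
        using * by eventually_elim (use g(2) in \<open>auto simp: std.sat_lift\<close>)
      then show ?thesis
        using g(1) by (auto simp: tval_up IH[OF comp[OF g(1)]] case_nat_app eventually_conj_iff intro!: exI[of _ g])
    qed
  qed
  show ?thesis
    using assms
  proof (induction arbitrary: \<rho> rule: is_Delta0.induct)
    case (4 \<phi> \<psi>)
    then show ?case by (simp add: eventually_imp_iff)
  next
    case (5 \<phi> t)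
    have "is_Delta0 (Neg \<phi>)" by (intro is_Delta0_rules 5)
    then have "up.sat \<rho> (BEx t (Neg \<phi>)) \<longleftrightarrow> (\<forall>\<^sub>F i in U. std.sat (\<lambda>n. \<rho> n i) (BEx t (Neg \<phi>)))"
      by (rule BEx_step) (simp_all add: 5 not_eventually_iff)
    then have "\<not> up.sat \<rho> (BAll t \<phi>) \<longleftrightarrow> (\<forall>\<^sub>F i in U. \<not> std.sat (\<lambda>n. \<rho> n i) (BAll t \<phi>))"
      by simp
    then show ?case
      by (simp only: not_eventually_iff[symmetric] not_not) blast
  next
    case (6 \<phi> t)
    show ?case by (rule BEx_step[OF 6(1) 6(2) 6(3)])
  qed (simp_all add: tval_up nonbot)
qed

text \<open>Truth at every index makes the search in \<open>skolem\<close> halt everywhere, so the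
  witnesses are total computable functions and belong to the model.\<close>

lemma Sigma1_transfer:
  assumes "is_Sigma 1 \<phi>" "\<And>n. computable (\<rho> n)" "\<And>i. std.sat (\<lambda>n. \<rho> n i) \<phi>"
  shows "up.sat \<rho> \<phi>"
proof -
  obtain k \<delta> where \<phi>: "\<phi> = (Ex ^^ k) \<delta>" and \<delta>: "is_Delta0 \<delta>"
    using assms(1) by (auto elim: is_Sigma_SucE)
  obtain v where v: "\<And>j. computable (v j)"
    and sat: "\<And>i. std.sat (\<lambda>n. if n < k then v n i else \<rho> (n - k) i) \<delta>"
    using skolem[of \<delta> \<rho> k, OF \<delta> assms(2)] assms(3) unfolding \<phi> by blast
  have "computable (if n < k then v n else \<rho> (n - k))" for n
    using v assms(2) by simp
  moreover have "(\<lambda>n. (if n < k then v n else \<rho> (n - k)) i) = (\<lambda>n. if n < k then v n i else \<rho> (n - k) i)" for i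
    by auto
  ultimately have "up.sat (\<lambda>n. if n < k then v n else \<rho> (n - k)) \<delta>"
    using sat by (subst Los[OF \<delta>]) simp_all
  with v show ?thesis
    unfolding \<phi> up.sat_Ex_pow by blast
qed

text \<open>The universal variables range over functions; at each index the standard model supplies
  the corresponding instance, to which \<open>Sigma1_transfer\<close> applies.\<close>

lemma Pi2_transfer:
  assumes "is_Pi 2 \<phi>" "\<And>n. computable (\<rho> n)" "\<And>i. std.sat (\<lambda>n. \<rho> n i) \<phi>"
  shows "up.sat \<rho> \<phi>"
proof -
  obtain k \<psi> where \<phi>: "\<phi> = (All ^^ k) \<psi>" and \<psi>: "is_Sigma 1 \<psi>"
    using assms(1) by (auto simp: numeral_2_eq_2 elim: is_Pi_SucE)
  show ?thesis
    unfolding \<phi> up.sat_All_pow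
  proof (intro allI impI)
    fix v :: "nat \<Rightarrow> nat \<Rightarrow> nat" assume v: "\<forall>j<k. v j \<in> Collect computable"
    show "up.sat (\<lambda>n. if n < k then v n else \<rho> (n - k)) \<psi>"
    proof (rule Sigma1_transfer[OF \<psi>])
      show "computable (if n < k then v n else \<rho> (n - k))" for n
        using v assms(2) by simp
      have "std.sat (\<lambda>n. if n < k then v n i else \<rho> (n - k) i) \<psi>" for i
        using assms(3)[of i] unfolding \<phi> std.sat_All_pow by simp
      moreover have "(\<lambda>n. (if n < k then v n else \<rho> (n - k)) i) = (\<lambda>n. if n < k then v n i else \<rho> (n - k) i)" for i
        by auto
      ultimately show "std.sat (\<lambda>n. (if n < k then v n else \<rho> (n - k)) i) \<psi>" for i
        by simp
    qed
  qed
qed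

text \<open>The witnesses of the outer block are standard numbers, which enter the model as constant
  functions; what remains is Pi_2.\<close>

lemma Sigma3_transfer:
  assumes "is_Sigma 3 \<phi>" "std.sat \<rho> \<phi>"
  shows "up.sat (\<lambda>n _. \<rho> n) \<phi>"
proof -
  obtain k \<psi> where \<phi>: "\<phi> = (Ex ^^ k) \<psi>" and \<psi>: "is_Pi 2 \<psi>"
    using assms(1) by (auto simp: numeral_2_eq_2 numeral_3_eq_3 elim: is_Sigma_SucE)
  obtain v where v: "std.sat (\<lambda>n. if n < k then v n else \<rho> (n - k)) \<psi>"
    using assms(2) unfolding \<phi> std.sat_Ex_pow by blast
  have "up.sat (\<lambda>n. if n < k then (\<lambda>_. v n) else (\<lambda>_. \<rho> (n - k))) \<psi>"
  proof (rule Pi2_transfer[OF \<psi>])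
    show "computable (if n < k then (\<lambda>_. v n) else (\<lambda>_. \<rho> (n - k)))" for n
      by (simp add: computable_const)
    have "(\<lambda>n. (if n < k then (\<lambda>_. v n) else (\<lambda>_. \<rho> (n - k))) i) = (\<lambda>n. if n < k then v n else \<rho> (n - k))" for i :: nat
      by auto
    with v show "std.sat (\<lambda>n. (if n < k then (\<lambda>_. v n) else (\<lambda>_. \<rho> (n - k))) i) \<psi>" for i :: nat
      by simp
  qed
  then show ?thesis
    unfolding \<phi> up.sat_Ex_pow by (intro exI[of _ "\<lambda>n _. v n"]) (simp add: computable_const)
qed

text \<open>Provable equivalence is sound in both structures: the truth of \<open>\<phi>\<close>
  passes to its Pi_2 form, moves over, and passes back.\<close>

lemma eqv_Pi2_transfer:
  assumes "eqv_Pi 2 \<phi>" "\<And>\<rho>. std.sat \<rho> \<phi>" "\<And>n. computable (\<rho> n)"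
  shows "up.sat \<rho> \<phi>"
proof -
  obtain \<psi> where \<psi>: "is_Pi 2 \<psi>" "{\<phi>} \<turnstile> \<psi>" "{\<psi>} \<turnstile> \<phi>"
    using assms(1) by (auto simp: eqv_Pi_def eqv_def)
  have "std.sat \<rho> \<psi>" for \<rho>
    by (rule std.soundness[OF \<psi>(2)]) (simp_all add: assms(2))
  then have "up.sat \<rho> \<psi>"
    by (intro Pi2_transfer \<psi>(1) assms(3))
  then show ?thesis
    by (intro up.soundness[OF \<psi>(3)]) (simp_all add: up_env_iff assms(3))
qed

lemma up_Pminus: "\<alpha> \<in> Pminus \<Longrightarrow> (\<And>n. computable (\<rho> n)) \<Longrightarrow> up.sat \<rho> \<alpha>"
  by (rule eqv_Pi2_transfer[OF eqv_Pi_Pminus std_Pminus])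

section \<open>Failure of an instance of \<open>P_axiom\<close>\<close>

lemma up_le_iff:
  fixes f g :: "nat \<Rightarrow> nat"
  shows "(\<forall>\<^sub>F i in U. f i < g i) \<or> (\<forall>\<^sub>F i in U. f i = g i) \<longleftrightarrow> (\<forall>\<^sub>F i in U. f i \<le> g i)"
proof -
  have "(\<forall>\<^sub>F i in U. f i \<le> g i) \<longleftrightarrow> (\<forall>\<^sub>F i in U. \<not> f i < g i \<longrightarrow> f i = g i)"
    by (intro eventually_cong always_eventually) auto
  then show ?thesis
    unfolding eventually_imp_iff not_eventually_iff[symmetric] by blast
qed

text \<open>One step of a possibly nonstandard code at a standard index: \<open>j\<close> and
  \<open>l\<close> enter as constant functions, and \<open>Los\<close> supplies the length and entry
  conditions.\<close>

lemma Approx_step: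
  assumes "up.sat (case_nat s \<rho>) (Approx k \<phi> (Var 0))" "\<And>n. computable (\<rho> n)"
    and "computable s" "computable x" "computable y" "computable u" "computable v"
    and "\<forall>\<^sub>F i in U. \<exists>p. s i = pr l p" "j + 1 < l"
    and "\<And>i. entry (s i) j (u i)" "\<And>i. entry (s i) (j + 1) (v i)"
    and "\<forall>\<^sub>F i in U. x i \<le> u i"
    and "up.sat (case_nat x (case_nat y (\<lambda>n. case_nat s \<rho> (n + k)))) \<phi>"
  shows "\<forall>\<^sub>F i in U. y i \<le> v i"
proof -
  define \<rho>' where "\<rho>' = case_nat v (case_nat u (case_nat (\<lambda>_. l) (case_nat y (case_nat x (case_nat (\<lambda>_. j) (case_nat s \<rho>))))))"
  have \<rho>': "computable (\<rho>' n)" for n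
    unfolding \<rho>'_def using assms(2-7) computable_const by (auto split: nat.split)
  have std: "(\<lambda>n. \<rho>' n i) = case_nat (v i) (case_nat (u i) (case_nat l (case_nat (y i) (case_nat (x i) (case_nat j (case_nat (s i) (\<lambda>n. \<rho> n i)))))))" for i
    unfolding \<rho>'_def by (auto simp: fun_eq_iff split: nat.split)
  have "up.sat \<rho>' (lth_fm (shift 6 (Var 0)) (Var 2))"
    unfolding Los[OF is_Delta0_lth \<rho>'] std using assms(8) by simp
  moreover have "up.sat \<rho>' (entry_fm (shift 6 (Var 0)) (Var 5) (Var 1))"
    unfolding Los[OF is_Delta0_entry \<rho>'] std using assms(10) by (simp add: entry_def)
  moreover have "up.sat \<rho>' (entry_fm (shift 6 (Var 0)) (Succ (Var 5)) (Var 0))"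
    unfolding Los[OF is_Delta0_entry \<rho>'] std using assms(11) by (simp add: entry_def Succ_def)
  moreover have "\<forall>\<^sub>F i in U. j + Suc 0 < l"
    using assms(9) by simp
  ultimately show ?thesis
    using assms(1,3-7,12,13) computable_const
    unfolding up.sat_Approx Let_def up_le_iff \<rho>'_def by blast
qed

text \<open>
  An approximation \<open>s\<close> of length 3 to the universal function at the nonstandard input \<open>id\<close> would
  satisfy \<open>(s)\<^sub>1 \<ge> id\<close>, as program \<open>0\<close> computes the identity. So \<open>(s)\<^sub>1\<close> bounds all standard programs
  and \<open>(s)\<^sub>2\<close> bounds all their values, that is, the whole model.
\<close>

lemma not_up_P_axiom: "\<not> up.sat \<rho> (univ_closure (P_axiom univ_fm))"
proof
  assume "up.sat \<rho> (univ_closure (P_axiom univ_fm))"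
  define \<rho>' :: "nat \<Rightarrow> nat \<Rightarrow> nat" where "\<rho>' = (\<lambda>_ i. i)"
  have \<rho>': "computable (\<rho>' n)" for n
    by (simp add: \<rho>'_def computable_id)
  have P: "up.sat \<rho>' (P_axiom univ_fm)"
    by (rule up.sat_univ_closureD) (fact, simp add: up_env_iff \<rho>')
  \<comment> \<open>Functionality of the universal relation is a true Pi_1 fact, hence inherited by
    the ultrapower.\<close>
  have "eqv_Pi 2 (PFUN univ_fm)"
    using eqv_Pi_Suc[OF eqv_Pi_PFUN[OF is_Sigma_univ_fm]] by (simp add: numeral_2_eq_2)
  then have "up.sat \<rho>' (PFUN univ_fm)"
    by (rule eqv_Pi2_transfer) (auto simp: std.sat_PFUN std_univ_fm \<rho>' intro: outputs_functional)
  with P have "up.sat (case_nat (\<lambda>_. 3) \<rho>') (Ex (And (Approx 2 univ_fm (Var 0)) (lth_fm (Var 0) (Var 1))))"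
    by (simp add: P_axiom_def computable_const)
  then obtain s where s: "computable s"
    and approx: "up.sat (case_nat s (case_nat (\<lambda>_. 3) \<rho>')) (Approx 2 univ_fm (Var 0))"
    and lth: "up.sat (case_nat s (case_nat (\<lambda>_. 3) \<rho>')) (lth_fm (Var 0) (Var 1))"
    by auto
  have comp: "computable (case_nat (\<lambda>_. 3) \<rho>' n)" for n
    using \<rho>' computable_const by (auto split: nat.split)
  then have "computable (case_nat s (case_nat (\<lambda>_. 3) \<rho>') n)" for n
    using s by (auto split: nat.split)
  then have len: "\<forall>\<^sub>F i in U. \<exists>p. s i = pr 3 p"
    using lth by (simp add: Los[OF is_Delta0_lth])
  obtain u where u: "\<And>j. computable (u j)" "\<And>i j. entry (s i) j (u j i)"
  proof -
    have "\<exists>u. computable u \<and> (\<forall>i. entry (s i) j (u i))" for j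
      using computable_entry[OF s] by metis
    then show thesis using that by metis
  qed
  have sat_univ: "up.sat (case_nat (\<lambda>_. e) (case_nat f (\<lambda>n. case_nat s (case_nat (\<lambda>_. 3) \<rho>') (n + 2)))) univ_fm"
    if "computable f" "\<And>i. outputs e i (f i)" for e f
  proof (rule Sigma1_transfer[OF is_Sigma_univ_fm])
    show "computable (case_nat (\<lambda>_. e) (case_nat f (\<lambda>n. case_nat s (case_nat (\<lambda>_. 3) \<rho>') (n + 2))) n)" for n
      using that(1) \<rho>' computable_const by (auto split: nat.split)
    show "std.sat (\<lambda>n. case_nat (\<lambda>_. e) (case_nat f (\<lambda>n. case_nat s (case_nat (\<lambda>_. 3) \<rho>') (n + 2))) n i) univ_fm" for i
      using that(2)[of i] by (simp add: std_univ_fm \<rho>'_def)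
  qed
  \<comment> \<open>The step at index 0 for program 0, which is below \<open>u 0\<close> whatever
    that entry is.\<close>
  have 1: "\<forall>\<^sub>F i in U. i \<le> u 1 i"
    using Approx_step[OF approx comp s computable_const[of 0] computable_id u(1)[of 0] u(1)[of 1] len, of 0]
      sat_univ[OF computable_id outputs_id] u(2) by simp
  \<comment> \<open>One more than the last entry. Its program \<open>e\<close> is standard, hence
    almost everywhere below \<open>u 1\<close>, so the step at index 1 bounds \<open>f\<close> by
    \<open>u 2\<close>.\<close>
  define f where "f i = u 2 i + 1" for i
  have f: "computable f"
    unfolding f_def by (intro computable_add u computable_const)
  then obtain e where e: "\<And>i. outputs e i (f i)"
    unfolding computable_def by blast
  have "\<forall>\<^sub>F i in U. e \<le> i"
    using free by (rule filter_leD) (rule eventually_ge_at_top)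
  with 1 have "\<forall>\<^sub>F i in U. e \<le> u 1 i"
    by eventually_elim simp
  then have "\<forall>\<^sub>F i in U. f i \<le> u 2 i"
    using Approx_step[OF approx comp s computable_const[of e] f u(1)[of 1] u(1)[of 2] len, of 1]
      sat_univ[OF f e] u(2)[of _ "Suc 0"] u(2)[of _ 2] by (simp add: numeral_2_eq_2)
  then have "\<forall>\<^sub>F i in U. False"
    by eventually_elim (simp add: f_def)
  with nonbot show False by (simp add: trivial_limit_def)
qed

text \<open>Stated for any set of sentences whose truth passes from the standard model to the
  ultrapower, so that it serves both the Sigma_3 and the Delta_3 claim. The members of
  \<open>T\<close> would be theorems of \<open>PSigma1\<close> and so true in the standard
  model.\<close>

lemma not_same_theorems:
  assumes "\<And>\<phi> \<rho>. \<phi> \<in> T \<Longrightarrow> (\<And>\<rho>. std.sat \<rho> \<phi>) \<Longrightarrow> up.sat (\<lambda>_ _. 0) \<phi>" "\<And>\<phi>. \<phi> \<in> T \<Longrightarrow> sentence \<phi>"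
  shows "\<not> same_theorems (Pminus \<union> T) PSigma1"
proof
  assume same: "same_theorems (Pminus \<union> T) PSigma1"
  have T: "up.sat (\<lambda>_ _. 0) \<phi>" if "\<phi> \<in> T" for \<phi>
  proof (rule assms(1)[OF that])
    have "PSigma1 \<turnstile> \<phi>"
      using same assms(2)[OF that] that unfolding same_theorems_def by (blast intro: Assm)
    then show "std.sat \<rho> \<phi>" for \<rho>
      by (rule std.soundness) (simp_all add: std_PSigma1)
  qed
  have "univ_closure (P_axiom univ_fm) \<in> PSigma1"
    unfolding PSigma1_def using is_Sigma_univ_fm by blast
  then have "Pminus \<union> T \<turnstile> univ_closure (P_axiom univ_fm)"
    using same sentence_univ_closure unfolding same_theorems_def by (blast intro: Assm)
  then have "up.sat (\<lambda>_ _. 0) (univ_closure (P_axiom univ_fm))"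
    by (rule up.soundness) (use T in \<open>auto simp: up_env_iff computable_const intro: up_Pminus\<close>)
  then show False by (simp add: not_up_P_axiom)
qed

end

theorem theorem2p2:
  shows "(\<exists>T. (\<forall>\<phi>\<in>T. sentence \<phi> \<and> is_Pi 3 \<phi>) \<and> same_theorems T PSigma1)
    \<and> \<not> (\<exists>T. (\<forall>\<phi>\<in>T. sentence \<phi> \<and> is_Sigma 3 \<phi>) \<and> same_theorems (Pminus \<union> T) PSigma1)
    \<and> \<not> (\<exists>T. (\<forall>\<phi>\<in>T. sentence \<phi> \<and> is_Delta_over Pminus 3 \<phi>)
           \<and> same_theorems (Pminus \<union> T) PSigma1)"
proof -
  obtain U :: "nat filter" where "U \<noteq> bot" "U \<le> sequentially"
    "\<And>P. eventually P U \<or> eventually (\<lambda>i. \<not> P i) U"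
    using exists_free_ultrafilter by blast
  then interpret ultrapower U
    by unfold_locales
  have \<Sigma>: "up.sat (\<lambda>_ _. 0) \<sigma>" if "is_Sigma 3 \<sigma>" "\<And>\<rho>. std.sat \<rho> \<sigma>" for \<sigma>
    using Sigma3_transfer[OF that(1), of "\<lambda>_. 0"] that(2) by simp
  \<comment> \<open>Both structures satisfy \<open>Pminus\<close>, so \<open>\<phi>\<close> and its
    Sigma_3 equivalent agree in each of them.\<close>
  have \<Delta>: "up.sat (\<lambda>_ _. 0) \<phi>" if \<phi>: "is_Delta_over Pminus 3 \<phi>" "\<And>\<rho>. std.sat \<rho> \<phi>" for \<phi>
  proof -
    obtain \<sigma> where \<sigma>: "is_Sigma 3 \<sigma>" "Pminus \<turnstile> Iff \<phi> \<sigma>"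
      using \<phi>(1) unfolding is_Delta_over_def by blast
    have "std.sat \<rho> (Iff \<phi> \<sigma>)" for \<rho>
      by (rule std.soundness[OF \<sigma>(2)]) (simp_all add: std_Pminus)
    with \<phi>(2) have "up.sat (\<lambda>_ _. 0) \<sigma>"
      by (intro \<Sigma> \<sigma>(1)) simp
    moreover have "up.sat (\<lambda>_ _. 0) (Iff \<phi> \<sigma>)"
      by (rule up.soundness[OF \<sigma>(2)]) (simp_all add: up_env_iff computable_const up_Pminus)
    ultimately show ?thesis by simp
  qed
  show ?thesis
  proof (intro conjI notI)
    show "\<exists>T. (\<forall>\<phi>\<in>T. sentence \<phi> \<and> is_Pi 3 \<phi>) \<and> same_theorems T PSigma1"
      by (rule PSigma1_Pi3)
  next
    assume "\<exists>T. (\<forall>\<phi>\<in>T. sentence \<phi> \<and> is_Sigma 3 \<phi>) \<and> same_theorems (Pminus \<union> T) PSigma1"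
    then show False
      using not_same_theorems \<Sigma> by blast
  next
    assume "\<exists>T. (\<forall>\<phi>\<in>T. sentence \<phi> \<and> is_Delta_over Pminus 3 \<phi>) \<and> same_theorems (Pminus \<union> T) PSigma1"
    then show False
      using not_same_theorems \<Delta> by blast
  qed
qed

end
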